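(* Let $D\subset\mathbb{C}^n$ be a bounded homogeneous domain with $0\in D$ and let $\psi\in H(D)$ induce a bounded multiplication operator $M_\psi$ on $\mathcal{B}(D)$ (respectively on $\mathcal{B}_{0^*}(D)$). Then the spectrum of $M_\psi$ acting on that space is $\sigma(M_\psi)=\overline{\psi(D)}$.
   Context: A domain $D\subset\mathbb{C}^n$ is homogeneous if its group of biholomorphic self-maps acts transitively on $D$. $H(D)$ denotes the holomorphic functions $D\to\mathbb{C}$. For $f\in H(D)$ and $z\in D$, $Q_f(z)=\sup_{u\in\mathbb{C}^n\setminus\{0\}}\frac{|\nabla f(z)u|}{H_z(u,\bar u)^{1/2}}$, where $\nabla f(z)u=\sum_{j=1}^n\frac{\partial f}{\partial z_j}(z)u_j$ and $H_z$ is the Bergman metric of $D$; $\beta_f=\sup_{z\in D}Q_f(z)$. The Bloch space $\mathcal{B}(D)$ is the set of $f\in H(D)$ with $\beta_f<\infty$, with norm $\|f\|_{\mathcal{B}}=|f(0)|+\beta_f$. The $*$-little Bloch space is $\mathcal{B}_{0^*}(D)=\{f\in\mathcal{B}(D):\lim_{z\to\partial^*D}Q_f(z)=0\}$ with the same norm, where $\partial^*D$ is the distinguished boundary of $D$. $M_\psi f=\psi f$; the spectrum is $\sigma(T)=\{\lambda\in\mathbb{C}:T-\lambda I\text{ is not invertible}\}$. *)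

theory Defs
  imports "HOL-Analysis.Analysis"
begin

definition holo :: "(complex ^ 'n) set \<Rightarrow> (complex ^ 'n \<Rightarrow> complex) \<Rightarrow> bool" where
  "holo D f \<longleftrightarrow> (\<forall>z\<in>D. \<exists>L. (f has_derivative L) (at z) \<and>
                         (\<forall>c v. L (c *s v) = c * L v))"

definition holo_map :: "(complex ^ 'n) set \<Rightarrow> (complex ^ 'n \<Rightarrow> complex ^ 'n) \<Rightarrow> bool" where
  "holo_map D \<phi> \<longleftrightarrow> (\<forall>i. holo D (\<lambda>z. \<phi> z $ i))"

definition biholo_auto :: "(complex ^ 'n) set \<Rightarrow> (complex ^ 'n \<Rightarrow> complex ^ 'n) \<Rightarrow> bool" where
  "biholo_auto D \<phi> \<longleftrightarrow> holo_map D \<phi> \<and> bij_betw \<phi> D D \<and>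
     (\<exists>\<theta>. holo_map D \<theta> \<and> (\<forall>z\<in>D. \<theta> (\<phi> z) = z \<and> \<phi> (\<theta> z) = z))"

definition domain :: "(complex ^ 'n) set \<Rightarrow> bool" where
  "domain D \<longleftrightarrow> open D \<and> connected D \<and> D \<noteq> {}"

definition homogeneous_domain :: "(complex ^ 'n) set \<Rightarrow> bool" where
  "homogeneous_domain D \<longleftrightarrow> domain D \<and>
     (\<forall>z\<in>D. \<forall>w\<in>D. \<exists>\<phi>. biholo_auto D \<phi> \<and> \<phi> z = w)"

definition A2 :: "(complex ^ 'n) set \<Rightarrow> (complex ^ 'n \<Rightarrow> complex) set" where
  "A2 D = {f. holo D f \<and> integrable (lebesgue_on D) (\<lambda>z. (cmod (f z))\<^sup>2)}"

text \<open>Bergman kernel K(z,w) = bergman_kernel D w z, characterised by the reproducing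
  property: K(.,w) \<in> A^2(D) and f(w) = \<integral>_D f(z) conj(K(z,w)) dV(z) for all f \<in> A^2(D).
  (Functions are taken to vanish outside D to make the kernel unique.)\<close>
definition bergman_kernel :: "(complex ^ 'n) set \<Rightarrow> complex ^ 'n \<Rightarrow> complex ^ 'n \<Rightarrow> complex" where
  "bergman_kernel D w = (THE g. g \<in> A2 D \<and> (\<forall>z. z \<notin> D \<longrightarrow> g z = 0) \<and>
      (\<forall>f\<in>A2 D. f w = integral\<^sup>L (lebesgue_on D) (\<lambda>z. f z * cnj (g z))))"

text \<open>Bergman metric H_z(u,conj u) = \<Sum>_{j,k} d^2 log K(z,z)/dz_j d(conj z_k) u_j conj(u_k),
  written out as the Levi form of the real function phi = log K(z,z):
  (1/4)(D^2 phi(z)[u,u] + D^2 phi(z)[iu,iu]).\<close>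
definition log_bergman :: "(complex ^ 'n) set \<Rightarrow> complex ^ 'n \<Rightarrow> real" where
  "log_bergman D z = ln (Re (bergman_kernel D z z))"

definition bergman_metric :: "(complex ^ 'n) set \<Rightarrow> complex ^ 'n \<Rightarrow> complex ^ 'n \<Rightarrow> real" where
  "bergman_metric D z u =
     (deriv (deriv (\<lambda>t::real. log_bergman D (z + t *\<^sub>R u))) 0
    + deriv (deriv (\<lambda>t::real. log_bergman D (z + t *\<^sub>R (\<i> *s u)))) 0) / 4"

definition Qf :: "(complex ^ 'n) set \<Rightarrow> (complex ^ 'n \<Rightarrow> complex) \<Rightarrow> complex ^ 'n \<Rightarrow> ereal" where
  "Qf D f z = (SUP u\<in>UNIV - {0}.
      ereal (cmod (frechet_derivative f (at z) u) / sqrt (bergman_metric D z u)))"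

definition beta :: "(complex ^ 'n) set \<Rightarrow> (complex ^ 'n \<Rightarrow> complex) \<Rightarrow> ereal" where
  "beta D f = (SUP z\<in>D. Qf D f z)"

text \<open>Elements of the function spaces are represented by functions vanishing outside D.\<close>
definition bloch :: "(complex ^ 'n) set \<Rightarrow> (complex ^ 'n \<Rightarrow> complex) set" where
  "bloch D = {f. holo D f \<and> (\<forall>z. z \<notin> D \<longrightarrow> f z = 0) \<and> beta D f < \<infinity>}"

definition bloch_norm :: "(complex ^ 'n) set \<Rightarrow> (complex ^ 'n \<Rightarrow> complex) \<Rightarrow> real" where
  "bloch_norm D f = cmod (f 0) + real_of_ereal (beta D f)"

definition disc_alg :: "(complex ^ 'n) set \<Rightarrow> (complex ^ 'n \<Rightarrow> complex) set" where
  "disc_alg D = {f. continuous_on (closure D) f \<and> holo D f}"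

definition max_boundary :: "(complex ^ 'n) set \<Rightarrow> (complex ^ 'n) set \<Rightarrow> bool" where
  "max_boundary D S \<longleftrightarrow> closed S \<and> S \<subseteq> closure D \<and>
     (\<forall>f\<in>disc_alg D. \<forall>z\<in>closure D. \<exists>\<xi>\<in>S. cmod (f z) \<le> cmod (f \<xi>))"

definition dist_boundary :: "(complex ^ 'n) set \<Rightarrow> (complex ^ 'n) set" where
  "dist_boundary D = \<Inter> {S. max_boundary D S}"

definition little_bloch_star :: "(complex ^ 'n) set \<Rightarrow> (complex ^ 'n \<Rightarrow> complex) set" where
  "little_bloch_star D = {f \<in> bloch D. \<forall>e>0. \<exists>\<delta>>0. \<forall>z\<in>D.
       infdist z (dist_boundary D) < \<delta> \<longrightarrow> Qf D f z < ereal e}"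

definition mult_op :: "(complex ^ 'n) set \<Rightarrow> (complex ^ 'n \<Rightarrow> complex) \<Rightarrow>
     (complex ^ 'n \<Rightarrow> complex) \<Rightarrow> (complex ^ 'n \<Rightarrow> complex)" where
  "mult_op D \<psi> f = (\<lambda>z. if z \<in> D then \<psi> z * f z else 0)"

definition bounded_op_on :: "('a \<Rightarrow> complex) set \<Rightarrow> (('a \<Rightarrow> complex) \<Rightarrow> real) \<Rightarrow>
     (('a \<Rightarrow> complex) \<Rightarrow> ('a \<Rightarrow> complex)) \<Rightarrow> bool" where
  "bounded_op_on X nrm T \<longleftrightarrow> (\<forall>f\<in>X. T f \<in> X) \<and> (\<exists>C. \<forall>f\<in>X. nrm (T f) \<le> C * nrm f)"

definition invertible_on :: "('a \<Rightarrow> complex) set \<Rightarrow> (('a \<Rightarrow> complex) \<Rightarrow> real) \<Rightarrow>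
     (('a \<Rightarrow> complex) \<Rightarrow> ('a \<Rightarrow> complex)) \<Rightarrow> bool" where
  "invertible_on X nrm T \<longleftrightarrow> (\<exists>S. bounded_op_on X nrm S \<and>
       (\<forall>g\<in>X. T (S g) = g) \<and> (\<forall>f\<in>X. S (T f) = f))"

definition spectrum_on :: "('a \<Rightarrow> complex) set \<Rightarrow> (('a \<Rightarrow> complex) \<Rightarrow> real) \<Rightarrow>
     (('a \<Rightarrow> complex) \<Rightarrow> ('a \<Rightarrow> complex)) \<Rightarrow> complex set" where
  "spectrum_on X nrm T = {c. \<not> invertible_on X nrm (\<lambda>f z. T f z - c * f z)}"

end

theory Submission
  imports Defs "HOL-Complex_Analysis.Complex_Analysis"
begin

text \<open>For \<open>c\<close> off the closure of \<open>\<psi>(D)\<close> put \<open>g = 1 / (\<psi> - c)\<close>. Since \<open>f D\<psi> = D(\<psi> f) - \<psi> Df\<close>, the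
  gradient of \<open>g f\<close> is a combination of those of \<open>f\<close> and \<open>\<psi> f\<close> with bounded coefficients, so \<open>M\<^sub>g\<close>
  is bounded and inverts \<open>M\<^sub>\<psi> - c\<close>. Conversely, if \<open>M\<^sub>g\<close> is bounded with norm at most \<open>C\<close>, then
  applying its powers to the constant 1 gives \<open>n |g|^(n-1) |Dg| \<le> C^n\<close> in the Bergman metric, which
  forces \<open>Dg = 0\<close> wherever \<open>|g| > C\<close>; hence \<open>g\<close> is bounded or constant, and \<open>c\<close> is not in the
  closure of \<open>\<psi>(D)\<close>. The Bergman metric of a bounded domain is positive by the strict
  Cauchy-Schwarz inequality for the first two Taylor coefficients of the kernel along a complex
  line, as affine functions separate these coefficients.\<close>

section \<open>Holomorphic functions of several variables\<close>

text \<open>The estimate for \<open>g f\<close> is made at each point: \<open>Qf\<close> of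
  \<open>g f\<close> at \<open>z\<close> is controlled by \<open>Qf\<close> of \<open>f\<close> and
  of \<open>\<psi> f\<close> at the same \<open>z\<close>, so finiteness of \<open>beta\<close> and
  decay at the distinguished boundary are inherited by one argument. The converse reads only
  gradients off the norm and reaches the closure by a direct bound on \<open>g\<close>. Much of the
  work comes from total functions: the kernel is a definite description and the metric an iterated
  \<open>deriv\<close>, which say nothing until existence and smoothness are shown, while
  \<open>x / 0 = 0\<close> would make \<open>Qf\<close> blind to directions of zero metric. The
  kernel comes from the Riesz theorem, hence from completeness of \<open>A2 D\<close> and, beneath
  it, a local bound by a mean value inequality. Riesz serves again to turn Taylor coefficients along
  a complex line into vectors; the diagonal of the kernel then becomes a real power series whose
  first three coefficients give the second derivatives.\<close>

lemma holo_has_derivative: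
  assumes "holo D f" "z \<in> D"
  shows "(f has_derivative frechet_derivative f (at z)) (at z)"
  using assms by (meson differentiableI frechet_derivative_works holo_def)

lemma holo_derivative_scale:
  assumes "holo D f" "z \<in> D"
  shows "frechet_derivative f (at z) (c *s v) = c * frechet_derivative f (at z) v"
  using assms by (metis frechet_derivative_at holo_def)

lemma holo_const: "holo D (\<lambda>_. c)"
  unfolding holo_def by (auto intro!: exI[of _ "\<lambda>_. 0"])

lemma holo_mult:
  assumes "holo D f" "holo D g"
  shows "holo D (\<lambda>z. f z * g z)"
  unfolding holo_def
proof
  fix z assume z: "z \<in> D"
  show "\<exists>L. ((\<lambda>z. f z * g z) has_derivative L) (at z) \<and> (\<forall>c v. L (c *s v) = c * L v)"
    by (rule exI, rule conjI, rule has_derivative_mult[OF holo_has_derivative[OF assms(1) z]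
        holo_has_derivative[OF assms(2) z]])
      (simp add: holo_derivative_scale[OF assms(1) z] holo_derivative_scale[OF assms(2) z] algebra_simps)
qed

lemma holo_add:
  assumes "holo D f" "holo D g"
  shows "holo D (\<lambda>z. f z + g z)"
  unfolding holo_def
proof
  fix z assume z: "z \<in> D"
  show "\<exists>L. ((\<lambda>z. f z + g z) has_derivative L) (at z) \<and> (\<forall>c v. L (c *s v) = c * L v)"
    by (rule exI, rule conjI, rule has_derivative_add[OF holo_has_derivative[OF assms(1) z]
        holo_has_derivative[OF assms(2) z]])
      (simp add: holo_derivative_scale[OF assms(1) z] holo_derivative_scale[OF assms(2) z] algebra_simps)
qed

lemma holo_compose_derivative:
  assumes "holo D f" "z \<in> D" "(\<phi> has_field_derivative d) (at (f z))"
  shows "((\<lambda>w. \<phi> (f w)) has_derivative (\<lambda>u. d * frechet_derivative f (at z) u)) (at z)"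
  using has_derivative_compose[OF holo_has_derivative[OF assms(1,2)]] assms(3)
  unfolding has_field_derivative_def by blast

lemma holo_compose:
  assumes "holo D f" "\<And>z. z \<in> D \<Longrightarrow> \<phi> field_differentiable (at (f z))"
  shows "holo D (\<lambda>z. \<phi> (f z))"
  unfolding holo_def
proof
  fix z assume z: "z \<in> D"
  obtain d where d: "(\<phi> has_field_derivative d) (at (f z))"
    using assms(2)[OF z] field_differentiable_def by blast
  show "\<exists>L. ((\<lambda>z. \<phi> (f z)) has_derivative L) (at z) \<and> (\<forall>c v. L (c *s v) = c * L v)"
    by (rule exI, rule conjI, rule holo_compose_derivative[OF assms(1) z d])
      (simp add: holo_derivative_scale[OF assms(1) z] algebra_simps)
qed

text \<open>Elements of the spaces are cut off to \<open>0\<close> outside \<open>D\<close> and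
  agree with the natural formulas only on \<open>D\<close>; as \<open>D\<close> is open, derivatives
  at its points do not see the difference.\<close>

lemma has_derivative_cong_open:
  assumes "open D" "z \<in> D" "\<And>w. w \<in> D \<Longrightarrow> f w = g w"
  shows "(f has_derivative L) (at z) \<longleftrightarrow> (g has_derivative L) (at z)"
  using assms has_derivative_transform_within_open by metis

lemma holo_cong:
  assumes "open D" "\<And>w. w \<in> D \<Longrightarrow> f w = g w" "holo D f"
  shows "holo D g"
  using assms(3) has_derivative_cong_open[of D _ f g, OF assms(1) _ assms(2)] unfolding holo_def by simp

lemma frechet_derivative_eqI:
  "(f has_derivative L) (at z) \<Longrightarrow> frechet_derivative f (at z) = L"
  using frechet_derivative_at by metis

lemma holo_mult_op:
  assumes "open D" "holo D f" "holo D g"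
  shows "holo D (mult_op D f g)"
  by (rule holo_cong[OF assms(1) _ holo_mult[OF assms(2,3)]]) (auto simp: mult_op_def)

lemma holo_inverse_shift:
  assumes "holo D \<psi>" "c \<notin> \<psi> ` D"
  shows "holo D (\<lambda>z. inverse (\<psi> z - c))"
  by (rule holo_compose[OF assms(1), of "\<lambda>w. inverse (w - c)"])
    (use assms(2) in \<open>force intro!: derivative_intros\<close>)

lemma mult_op_derivative:
  assumes "open D" "holo D f" "holo D g" "z \<in> D"
  shows "frechet_derivative (mult_op D f g) (at z) u
       = f z * frechet_derivative g (at z) u + frechet_derivative f (at z) u * g z"
proof -
  have "((\<lambda>w. f w * g w) has_derivative
      (\<lambda>h. f z * frechet_derivative g (at z) h + frechet_derivative f (at z) h * g z)) (at z)"
    using has_derivative_mult holo_has_derivative assms by blast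
  then have "(mult_op D f g has_derivative
      (\<lambda>h. f z * frechet_derivative g (at z) h + frechet_derivative f (at z) h * g z)) (at z)"
    by (subst has_derivative_cong_open[OF assms(1,4)]) (auto simp: mult_op_def)
  then show ?thesis
    by (simp add: frechet_derivative_eqI)
qed

section \<open>Multiplication operators on the Bloch spaces\<close>

context
  fixes D :: "(complex ^ 'n) set"
  assumes D: "open D" "connected D" "D \<noteq> {}"
    and metric_pos: "\<And>z u. z \<in> D \<Longrightarrow> u \<noteq> 0 \<Longrightarrow> 0 < bergman_metric D z u"
begin

lemma Qf_leI:
  assumes "z \<in> D" "\<And>u. u \<noteq> 0 \<Longrightarrow> cmod (frechet_derivative f (at z) u) \<le> c * sqrt (bergman_metric D z u)"
  shows "Qf D f z \<le> ereal c"
  unfolding Qf_def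
  by (rule SUP_least) (use assms metric_pos[OF assms(1)] in \<open>simp add: divide_simps\<close>)

text \<open>Positivity of the metric enters here: in a direction of zero metric the quotient in
  \<open>Qf\<close> would be \<open>0\<close> by \<open>x / 0 = 0\<close>, and a bound on
  \<open>Qf\<close> would say nothing about the derivative.\<close>

lemma Qf_leD:
  assumes "z \<in> D" "u \<noteq> 0" "Qf D f z \<le> ereal c"
  shows "cmod (frechet_derivative f (at z) u) \<le> c * sqrt (bergman_metric D z u)"
proof -
  have "ereal (cmod (frechet_derivative f (at z) u) / sqrt (bergman_metric D z u)) \<le> ereal c"
    using assms(2,3) unfolding Qf_def SUP_le_iff by blast
  then show ?thesis
    using metric_pos[OF assms(1,2)] by (simp add: divide_simps)
qed

lemma Qf_nonneg:
  assumes "z \<in> D"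
  shows "0 \<le> Qf D f z"
proof -
  \<comment> \<open>The all-ones vector is a concrete nonzero direction to put into the
    supremum.\<close>
  have "(1 :: complex ^ 'n) \<noteq> 0"
    by simp
  moreover have "0 \<le> ereal (cmod (frechet_derivative f (at z) 1) / sqrt (bergman_metric D z 1))"
    using metric_pos[OF assms, of 1] by (simp add: less_imp_le)
  ultimately show ?thesis
    unfolding Qf_def by (meson DiffI SUP_upper2 UNIV_I singletonD)
qed

lemma Qf_le_beta: "z \<in> D \<Longrightarrow> Qf D f z \<le> beta D f"
  unfolding beta_def by (rule SUP_upper)

lemma beta_nonneg: "0 \<le> beta D f"
  using D(3) Qf_nonneg Qf_le_beta order_trans by blast

text \<open>\<open>real_of_ereal\<close> sends \<open>\<infinity>\<close> to \<open>0\<close>, so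
  arithmetic with the real value is meaningful only once finiteness is known.\<close>

lemma beta_real:
  assumes "f \<in> bloch D"
  shows "beta D f = ereal (real_of_ereal (beta D f))"
  using assms beta_nonneg[of f] unfolding bloch_def by (cases "beta D f") auto

lemma Qf_real:
  assumes "f \<in> bloch D" "z \<in> D"
  shows "Qf D f z = ereal (real_of_ereal (Qf D f z))"
  using assms Qf_le_beta[of z f] Qf_nonneg[of z f] unfolding bloch_def
  by (cases "Qf D f z") auto

lemma beta_leI:
  assumes "\<And>z. z \<in> D \<Longrightarrow> Qf D f z \<le> ereal c"
  shows "beta D f \<le> ereal c" "real_of_ereal (beta D f) \<le> c"
proof -
  show 1: "beta D f \<le> ereal c"
    using assms unfolding beta_def by (rule SUP_least)
  then show "real_of_ereal (beta D f) \<le> c"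
    using beta_nonneg[of f] by (cases "beta D f") auto
qed

lemma bloch_derivative_bound:
  assumes "f \<in> bloch D" "z \<in> D" "u \<noteq> 0"
  shows "cmod (frechet_derivative f (at z) u) \<le> bloch_norm D f * sqrt (bergman_metric D z u)"
proof (rule Qf_leD[OF assms(2,3)])
  have "Qf D f z \<le> ereal (real_of_ereal (beta D f))"
    using Qf_le_beta[OF assms(2), of f] beta_real[OF assms(1)] by simp
  then show "Qf D f z \<le> ereal (bloch_norm D f)"
    unfolding bloch_norm_def by (meson ereal_less_eq(3) le_add_same_cancel2 norm_ge_zero order_trans)
qed

text \<open>A zero gradient meets the boundary condition for every \<delta>. This function is the
  starting vector for the powers of a multiplier and the test vector showing that
  \<open>\<psi> - c\<close> has no zero.\<close>

lemma one_in_little_bloch: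
  "mult_op D (\<lambda>_. 1) (\<lambda>_. 1) \<in> little_bloch_star D" (is "?e \<in> _")
  "bloch_norm D (mult_op D (\<lambda>_. 1) (\<lambda>_. 1)) \<le> 1"
proof -
  have 0: "Qf D ?e z \<le> ereal 0" if "z \<in> D" for z
    using that metric_pos[OF that]
    by (intro Qf_leI) (auto simp: mult_op_derivative[OF D(1)] holo_const frechet_derivative_eqI[OF has_derivative_const])
  have "?e \<in> bloch D"
    using beta_leI(1)[OF 0] holo_mult_op[OF D(1) holo_const holo_const]
    unfolding bloch_def by (auto simp: mult_op_def)
  then show "?e \<in> little_bloch_star D"
    unfolding little_bloch_star_def
    by (auto intro!: exI[of _ 1] le_less_trans[OF 0])
  show "bloch_norm D ?e \<le> 1"
    using beta_leI(2)[OF 0] unfolding bloch_norm_def by (smt (verit, best) mult_op_def mult_1 norm_one norm_zero)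
qed

text \<open>The constant comes from \<open>D(g f) = g (1 + g \<psi>) Df - g^2 D(\<psi> f)\<close> and \<open>g \<psi> = 1 + c g\<close>, where
  \<open>g = 1 / (\<psi> - c)\<close>.\<close>

lemma Qf_resolvent_le:
  assumes "holo D \<psi>" "c \<notin> \<psi> ` D" "f \<in> bloch D" "mult_op D \<psi> f \<in> bloch D" "z \<in> D"
    and G: "cmod (inverse (\<psi> z - c)) \<le> G"
  shows "Qf D (mult_op D (\<lambda>z. inverse (\<psi> z - c)) f) z \<le>
           ereal ((G * (2 + cmod c * G) + G\<^sup>2) *
             (real_of_ereal (Qf D f z) + real_of_ereal (Qf D (mult_op D \<psi> f) z)))"
proof -
  define g where "g = (\<lambda>z. inverse (\<psi> z - c))"
  define K where "K = G * (2 + cmod c * G) + G\<^sup>2"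
  define p where "p = real_of_ereal (Qf D f z)"
  define q where "q = real_of_ereal (Qf D (mult_op D \<psi> f) z)"
  have f: "holo D f"
    using assms(3) unfolding bloch_def by auto
  have g: "holo D g"
    unfolding g_def by (rule holo_inverse_shift[OF assms(1,2)])
  have ne: "\<psi> z - c \<noteq> 0"
    using assms(2,5) by auto
  have G0: "0 \<le> G"
    using G norm_ge_zero order_trans by blast
  have Dg: "frechet_derivative g (at z) u = - (g z)\<^sup>2 * frechet_derivative \<psi> (at z) u" for u
  proof -
    have "((\<lambda>w. inverse (w - c)) has_field_derivative - (inverse (\<psi> z - c))\<^sup>2) (at (\<psi> z))"
      using ne by (auto intro!: derivative_eq_intros simp: power2_eq_square)
    from frechet_derivative_eqI[OF holo_compose_derivative[OF assms(1,5) this]]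
    show ?thesis
      unfolding g_def by simp
  qed
  have "Qf D (mult_op D g f) z \<le> ereal (K * (p + q))"
  proof (rule Qf_leI[OF assms(5)])
    fix u :: "complex ^ 'n" assume u: "u \<noteq> 0"
    define a where "a = frechet_derivative f (at z) u"
    define b where "b = frechet_derivative (mult_op D \<psi> f) (at z) u"
    define s where "s = sqrt (bergman_metric D z u)"
    have s: "0 < s"
      unfolding s_def using metric_pos[OF assms(5) u] by simp
    have "cmod a \<le> p * s"
      unfolding a_def p_def s_def using Qf_leD[OF assms(5) u] Qf_real[OF assms(3,5)] by simp
    moreover have "cmod b \<le> q * s"
      unfolding b_def q_def s_def using Qf_leD[OF assms(5) u] Qf_real[OF assms(4,5)] by simp
    ultimately have ab: "cmod a + cmod b \<le> (p + q) * s"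
      by (simp add: algebra_simps)
    have gpsi: "g z * \<psi> z = 1 + c * g z"
      using ne unfolding g_def by (simp add: field_simps)
    have "frechet_derivative (mult_op D g f) (at z) u
        = g z * a - (g z)\<^sup>2 * (frechet_derivative \<psi> (at z) u * f z)"
      unfolding mult_op_derivative[OF D(1) g f assms(5)] Dg a_def by simp
    also have "frechet_derivative \<psi> (at z) u * f z = b - \<psi> z * a"
      unfolding b_def a_def mult_op_derivative[OF D(1) assms(1) f assms(5)] by simp
    also have "g z * a - (g z)\<^sup>2 * (b - \<psi> z * a) = g z * (1 + g z * \<psi> z) * a - (g z)\<^sup>2 * b"
      by (simp add: algebra_simps power2_eq_square)
    also have "\<dots> = g z * (2 + c * g z) * a - (g z)\<^sup>2 * b"
      unfolding gpsi by simp
    also have "cmod \<dots> \<le> cmod (g z) * cmod (2 + c * g z) * cmod a + (cmod (g z))\<^sup>2 * cmod b"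
      by (rule order_trans[OF norm_triangle_ineq4]) (simp add: norm_mult norm_power)
    also have "\<dots> \<le> G * (2 + cmod c * G) * cmod a + G\<^sup>2 * cmod b"
    proof -
      have "cmod (2 + c * g z) \<le> 2 + cmod c * G"
        using G by (intro order_trans[OF norm_triangle_ineq])
          (simp add: g_def norm_mult mult_left_mono)
      then show ?thesis
        using G G0 unfolding g_def
        by (intro add_mono mult_mono power_mono) auto
    qed
    also have "\<dots> \<le> K * (cmod a + cmod b)"
      unfolding K_def using G0 by (simp add: algebra_simps power2_eq_square)
    also have "\<dots> \<le> K * ((p + q) * s)"
      using ab G0 unfolding K_def by (intro mult_left_mono) auto
    finally show "cmod (frechet_derivative (mult_op D g f) (at z) u) \<le> K * (p + q) * s"
      by (simp add: mult.assoc)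
  qed
  then show ?thesis
    unfolding g_def K_def p_def q_def .
qed

text \<open>The pointwise estimate of \<open>Qf_resolvent_le\<close> is used twice: its supremum
  over \<open>D\<close> bounds \<open>beta\<close>, and its smallness near the distinguished
  boundary gives membership in the little space. The terms in \<open>\<psi> f\<close> are under
  control because multiplication by \<psi> preserves \<open>X\<close> and is bounded there.\<close>

lemma resolvent_bounded:
  assumes "holo D \<psi>" "c \<notin> closure (\<psi> ` D)" "X = bloch D \<or> X = little_bloch_star D" "0 \<in> D"
    and T: "bounded_op_on X (bloch_norm D) (mult_op D \<psi>)"
  shows "bounded_op_on X (bloch_norm D) (mult_op D (\<lambda>z. inverse (\<psi> z - c)))"
proof -
  define S where "S = mult_op D (\<lambda>z. inverse (\<psi> z - c))"
  have c: "c \<notin> \<psi> ` D"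
    using assms(2) closure_subset[of "\<psi> ` D"] by auto
  obtain r where r: "r > 0" "\<And>z. z \<in> D \<Longrightarrow> r \<le> cmod (\<psi> z - c)"
    using assms(2) unfolding closure_approachable by (auto simp: dist_norm not_less)
  define G where "G = 1 / r"
  have G: "cmod (inverse (\<psi> z - c)) \<le> G" if "z \<in> D" for z
    unfolding G_def norm_inverse inverse_eq_divide[symmetric]
    using r(1) r(2)[OF that] by (intro le_imp_inverse_le)
  have G0: "0 < G"
    using r(1) unfolding G_def by simp
  define K where "K = G * (2 + cmod c * G) + G\<^sup>2"
  have K0: "0 < K"
    using G0 unfolding K_def by (intro add_nonneg_pos mult_nonneg_nonneg) auto
  \<comment> \<open>Lets the value at \<open>0\<close>, which is multiplied by at most
    \<open>G\<close>, be absorbed into the constant for the gradient.\<close>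
  have KG: "G \<le> K"
    using G0 unfolding K_def by (simp add: algebra_simps)
  have X: "X \<subseteq> bloch D"
    using assms(3) unfolding little_bloch_star_def by auto
  obtain C0 where C0: "\<And>f. f \<in> X \<Longrightarrow> bloch_norm D (mult_op D \<psi> f) \<le> C0 * bloch_norm D f"
    using T unfolding bounded_op_on_def by auto
  define C where "C = max C0 0"
  have nrm0: "0 \<le> bloch_norm D f" for f
    unfolding bloch_norm_def using beta_nonneg[of f] by (simp add: real_of_ereal_pos)
  have C: "bloch_norm D (mult_op D \<psi> f) \<le> C * bloch_norm D f" if "f \<in> X" for f
    using C0[OF that] mult_right_mono[of C0 C, OF _ nrm0[of f]] unfolding C_def by simp
  have TX: "mult_op D \<psi> f \<in> X" if "f \<in> X" for f
    using T that unfolding bounded_op_on_def by blast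
  have Q: "Qf D (S f) z \<le> ereal (K * (real_of_ereal (Qf D f z) + real_of_ereal (Qf D (mult_op D \<psi> f) z)))"
    if "f \<in> X" "z \<in> D" for f z
    unfolding S_def K_def using Qf_resolvent_le[OF assms(1) c] that X TX G by blast
  have B: "beta D (S f) \<le> ereal (K * (real_of_ereal (beta D f) + real_of_ereal (beta D (mult_op D \<psi> f))))"
    "real_of_ereal (beta D (S f)) \<le> K * (real_of_ereal (beta D f) + real_of_ereal (beta D (mult_op D \<psi> f)))"
    if f: "f \<in> X" for f
  proof -
    have *: "real_of_ereal (Qf D h z) \<le> real_of_ereal (beta D h)" if "h \<in> bloch D" "z \<in> D" for h z
      using Qf_le_beta[OF that(2), of h] beta_real[OF that(1)] Qf_real[OF that]
      by (metis ereal_less_eq(3))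
    have "Qf D (S f) z \<le> ereal (K * (real_of_ereal (beta D f) + real_of_ereal (beta D (mult_op D \<psi> f))))"
      if z: "z \<in> D" for z
    proof -
      have "K * (real_of_ereal (Qf D f z) + real_of_ereal (Qf D (mult_op D \<psi> f) z)) \<le>
        K * (real_of_ereal (beta D f) + real_of_ereal (beta D (mult_op D \<psi> f)))"
        using * f z X TX K0 by (intro mult_left_mono add_mono) auto
      then show ?thesis
        using Q[OF f z] by (meson ereal_less_eq(3) order_trans)
    qed
    then show "beta D (S f) \<le> ereal (K * (real_of_ereal (beta D f) + real_of_ereal (beta D (mult_op D \<psi> f))))"
      "real_of_ereal (beta D (S f)) \<le> K * (real_of_ereal (beta D f) + real_of_ereal (beta D (mult_op D \<psi> f)))"
      by (fact beta_leI)+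
  qed
  have Sb: "S f \<in> bloch D" if f: "f \<in> X" for f
  proof -
    have "holo D (S f)"
      unfolding S_def using f X holo_inverse_shift[OF assms(1) c]
      by (auto intro!: holo_mult_op D(1) simp: bloch_def)
    then show ?thesis
      using B(1)[OF f] le_less_trans unfolding bloch_def by (auto simp: S_def mult_op_def)
  qed
  have SX: "S f \<in> X" if f: "f \<in> X" for f
  proof (cases "X = bloch D")
    case True
    then show ?thesis
      using Sb[OF f] by simp
  next
    case False
    then have Xl: "X = little_bloch_star D"
      using assms(3) by blast
    have "\<exists>\<delta>>0. \<forall>z\<in>D. infdist z (dist_boundary D) < \<delta> \<longrightarrow> Qf D (S f) z < ereal e" if e: "e > 0" for e
    proof -
      define e' where "e' = e / (2 * K)"
      have e': "e' > 0"
        using e K0 unfolding e'_def by simp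
      obtain d1 where d1: "d1 > 0"
        "\<And>z. z \<in> D \<Longrightarrow> infdist z (dist_boundary D) < d1 \<Longrightarrow> Qf D f z < ereal e'"
        using f e' unfolding Xl little_bloch_star_def by blast
      obtain d2 where d2: "d2 > 0"
        "\<And>z. z \<in> D \<Longrightarrow> infdist z (dist_boundary D) < d2 \<Longrightarrow> Qf D (mult_op D \<psi> f) z < ereal e'"
        using TX[OF f] e' unfolding Xl little_bloch_star_def by blast
      have "Qf D (S f) z < ereal e" if z: "z \<in> D" "infdist z (dist_boundary D) < min d1 d2" for z
      proof -
        have "real_of_ereal (Qf D f z) < e'"
          using d1(2)[OF z(1)] z(2) Qf_real[of f z] f X z(1) by (metis less_ereal.simps(1) min_less_iff_conj subsetD)
        moreover have "real_of_ereal (Qf D (mult_op D \<psi> f) z) < e'"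
          using d2(2)[OF z(1)] z(2) Qf_real[of "mult_op D \<psi> f" z] TX[OF f] X z(1) by (metis less_ereal.simps(1) min_less_iff_conj subsetD)
        ultimately have "K * (real_of_ereal (Qf D f z) + real_of_ereal (Qf D (mult_op D \<psi> f) z)) < K * (e' + e')"
          using K0 by (intro mult_strict_left_mono) auto
        also have "\<dots> = e"
          using K0 unfolding e'_def by (simp add: field_simps)
        finally show ?thesis
          using Q[OF f z(1)] by (meson ereal_less(2) le_less_trans less_ereal.simps(1))
      qed
      then show ?thesis
        using d1(1) d2(1) by (intro exI[of _ "min d1 d2"]) auto
    qed
    then show ?thesis
      using Sb[OF f] unfolding Xl little_bloch_star_def by blast
  qed
  have "bloch_norm D (S f) \<le> (K * (1 + C)) * bloch_norm D f" if f: "f \<in> X" for f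
  proof -
    have "cmod (S f 0) \<le> K * cmod (f 0)"
      using G[OF assms(4)] KG assms(4) unfolding S_def mult_op_def
      by (auto simp: norm_mult intro!: mult_right_mono)
    then have "bloch_norm D (S f) \<le> K * (cmod (f 0) + real_of_ereal (beta D f) + real_of_ereal (beta D (mult_op D \<psi> f)))"
      using B(2)[OF f] unfolding bloch_norm_def by (simp add: algebra_simps)
    also have "\<dots> \<le> K * (bloch_norm D f + C * bloch_norm D f)"
    proof -
      have "real_of_ereal (beta D (mult_op D \<psi> f)) \<le> C * bloch_norm D f"
        using C[OF f] unfolding bloch_norm_def by (smt (verit) norm_ge_zero)
      then show ?thesis
        using K0 unfolding bloch_norm_def by (intro mult_left_mono) auto
    qed
    finally show ?thesis
      by (simp add: algebra_simps)
  qed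
  then show ?thesis
    using SX unfolding bounded_op_on_def S_def by blast
qed

text \<open>If \<open>|g|\<close> exceeds the operator bound somewhere, the vanishing gradient makes
  \<open>g\<close> locally constant on that open set, and connectedness spreads one value over all
  of \<open>D\<close>.\<close>

lemma multiplier_bounded_or_constant:
  assumes g: "holo D g" and X: "X = bloch D \<or> X = little_bloch_star D"
    and M: "bounded_op_on X (bloch_norm D) (mult_op D g)"
  shows "(\<exists>C. \<forall>z\<in>D. cmod (g z) \<le> C) \<or> g constant_on D"
proof -
  have Xb: "X \<subseteq> bloch D"
    using X unfolding little_bloch_star_def by auto
  obtain C0 where C0: "\<And>f. f \<in> X \<Longrightarrow> bloch_norm D (mult_op D g f) \<le> C0 * bloch_norm D f"
    using M unfolding bounded_op_on_def by auto
  \<comment> \<open>Taken at least \<open>1\<close> so that powers of \<open>C\<close> are positive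
    and can be cancelled in the gradient estimate.\<close>
  define C where "C = max C0 1"
  have C1: "C \<ge> 1"
    unfolding C_def by simp
  have nrm0: "0 \<le> bloch_norm D f" for f
    unfolding bloch_norm_def using beta_nonneg[of f] by (simp add: real_of_ereal_pos)
  have C: "bloch_norm D (mult_op D g f) \<le> C * bloch_norm D f" if "f \<in> X" for f
    using C0[OF that] mult_right_mono[of C0 C, OF _ nrm0[of f]] unfolding C_def by simp
  define P where "P n = (mult_op D (\<lambda>z. g z ^ n) (\<lambda>_. 1))" for n
  have P: "P n \<in> X \<and> bloch_norm D (P n) \<le> C ^ n" for n
  proof (induction n)
    case 0
    show ?case
      using one_in_little_bloch X unfolding P_def little_bloch_star_def by auto
  next
    case (Suc n)
    have eq: "P (Suc n) = mult_op D g (P n)"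
      unfolding P_def mult_op_def by auto
    have "bloch_norm D (P (Suc n)) \<le> C * C ^ n"
      unfolding eq using C[of "P n"] Suc C1 by (meson mult_left_mono order_trans zero_le_one)
    then show ?case
      using Suc M unfolding eq bounded_op_on_def by auto
  qed
  have Dg0: "frechet_derivative g (at z) u = 0" if z: "z \<in> D" "cmod (g z) > C" for z u
  proof (rule ccontr)
    assume nz: "frechet_derivative g (at z) u \<noteq> 0"
    then have u: "u \<noteq> 0"
      using holo_derivative_scale[OF g z(1), of 0 0] by auto
    define a where "a = cmod (frechet_derivative g (at z) u)"
    define s where "s = sqrt (bergman_metric D z u)"
    have a: "a > 0"
      using nz unfolding a_def by simp
    \<comment> \<open>Here \<open>|g z| ^ n\<close> is at least \<open>C ^ n\<close>; cancelling
      this factor leaves the linear growth of \<open>Suc n\<close> against a constant.\<close>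
    have bd: "real (Suc n) * a \<le> C * s" for n
    proof -
      have "((\<lambda>w. w ^ Suc n) has_field_derivative (of_nat (Suc n) * g z ^ n)) (at (g z))"
        by (rule derivative_eq_intros | simp)+
      from holo_compose_derivative[OF g z(1) this]
      have "(P (Suc n) has_derivative (\<lambda>u. of_nat (Suc n) * g z ^ n * frechet_derivative g (at z) u)) (at z)"
        by (subst has_derivative_cong_open[OF D(1) z(1)]) (auto simp: P_def mult_op_def)
      then have "frechet_derivative (P (Suc n)) (at z) u = of_nat (Suc n) * g z ^ n * frechet_derivative g (at z) u"
        by (simp add: frechet_derivative_eqI)
      then have "real (Suc n) * cmod (g z) ^ n * a = cmod (frechet_derivative (P (Suc n)) (at z) u)"
        unfolding a_def by (simp only: norm_mult norm_power norm_of_nat)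
      also have "\<dots> \<le> bloch_norm D (P (Suc n)) * s"
        unfolding s_def using bloch_derivative_bound[OF _ z(1) u] P Xb by blast
      also have "\<dots> \<le> C ^ Suc n * s"
        using P[of "Suc n"] metric_pos[OF z(1) u] unfolding s_def by (intro mult_right_mono) auto
      finally have "real (Suc n) * cmod (g z) ^ n * a \<le> C ^ Suc n * s" .
      moreover have "real (Suc n) * C ^ n * a \<le> real (Suc n) * cmod (g z) ^ n * a"
        using z(2) C1 a by (intro mult_right_mono mult_left_mono power_mono) auto
      ultimately have "C ^ n * (real (Suc n) * a) \<le> C ^ n * (C * s)"
        by (simp add: mult_ac)
      then show ?thesis
        using C1 by simp
    qed
    obtain n where "real n > C * s / a"
      using reals_Archimedean2 by blast
    then have "C * s < real n * a"
      using a by (simp add: field_simps)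
    then show False
      using bd[of n] a by (simp add: algebra_simps)
  qed
  show ?thesis
  proof (cases "\<exists>z0\<in>D. cmod (g z0) > C")
    case False
    then show ?thesis
      by (meson not_less)
  next
    case True
    then obtain z0 where z0: "z0 \<in> D" "cmod (g z0) > C"
      by blast
    have cont: "continuous_on D g"
      by (rule has_derivative_continuous_on, rule has_derivative_at_withinI, rule holo_has_derivative[OF g])
    have "open (D \<inter> g -` {w. cmod w > C})"
      by (rule continuous_open_preimage[OF cont D(1)]) (simp add: open_Collect_less continuous_intros)
    \<comment> \<open>Having the value \<open>g z0\<close>, the point \<open>z\<close> lies in the
      open set \<open>|g| > C\<close>, where the derivative vanishes; so the level set of
      \<open>g z0\<close> is open as well as relatively closed.\<close>
    have op: "\<exists>e>0. ball z e \<inter> D \<subseteq> {w \<in> D. g w = g z0}" if z: "z \<in> D" "g z = g z0" for z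
    proof -
      have "z \<in> D \<inter> g -` {w. cmod w > C}"
        using z z0 by simp
      then obtain e where e: "e > 0" "ball z e \<subseteq> D \<inter> g -` {w. cmod w > C}"
        using \<open>open (D \<inter> g -` {w. cmod w > C})\<close> openE by blast
      have "(g has_derivative (\<lambda>_. 0)) (at w within ball z e)" if "w \<in> ball z e" for w
      proof -
        have w: "w \<in> D" "cmod (g w) > C"
          using e that by auto
        have "frechet_derivative g (at w) = (\<lambda>_. 0)"
          using Dg0[OF w] by auto
        then show ?thesis
          using holo_has_derivative[OF g w(1)] has_derivative_at_withinI by metis
      qed
      then have "g w = g z" if "w \<in> ball z e" for w
        using has_derivative_zero_unique[OF convex_ball] that e(1) by (metis centre_in_ball)
      then show ?thesis
        using e z by (intro exI[of _ e]) auto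
    qed
    have "openin (top_of_set D) {w \<in> D. g w = g z0}"
      unfolding openin_contains_ball using op by blast
    moreover have "closedin (top_of_set D) {w \<in> D. g w = g z0}"
      using continuous_closedin_preimage[OF cont, of "{g z0}"]
      by (simp add: vimage_def Int_def)
    ultimately have "{w \<in> D. g w = g z0} = D"
      using D(2) z0(1) unfolding connected_clopen by blast
    then show ?thesis
      unfolding constant_on_def by blast
  qed
qed

text \<open>Any inverse of \<open>M\<^sub>\<psi> - c\<close> must be multiplication by
  \<open>1 / (\<psi> - c)\<close>, so invertibility becomes a question about a single multiplier,
  answered in both directions by the two preceding lemmas.\<close>

lemma spectrum_mult_op:
  assumes \<psi>: "holo D \<psi>" and X: "X = bloch D \<or> X = little_bloch_star D" and "0 \<in> D"
    and T: "bounded_op_on X (bloch_norm D) (mult_op D \<psi>)"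
  shows "spectrum_on X (bloch_norm D) (mult_op D \<psi>) = closure (\<psi> ` D)"
proof -
  have X0: "f z = 0" if "f \<in> X" "z \<notin> D" for f z
    using that X unfolding little_bloch_star_def bloch_def by auto
  have "invertible_on X (bloch_norm D) (\<lambda>f z. mult_op D \<psi> f z - c * f z)" if c: "c \<notin> closure (\<psi> ` D)" for c
  proof -
    have "c \<notin> \<psi> ` D"
      using c closure_subset[of "\<psi> ` D"] by auto
    then have "\<psi> z - c \<noteq> 0" if "z \<in> D" for z
      using that by auto
    then have "mult_op D \<psi> (mult_op D (\<lambda>z. inverse (\<psi> z - c)) f) z
          - c * mult_op D (\<lambda>z. inverse (\<psi> z - c)) f z = f z"
        "mult_op D (\<lambda>z. inverse (\<psi> z - c)) (\<lambda>z. mult_op D \<psi> f z - c * f z) z = f z" if "f \<in> X" for f z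
      using X0[OF that, of z] by (auto simp: mult_op_def field_simps)
    then show ?thesis
      unfolding invertible_on_def using resolvent_bounded[OF \<psi> c X \<open>0 \<in> D\<close> T] by blast
  qed
  moreover have "c \<notin> closure (\<psi> ` D)"
    if inv: "invertible_on X (bloch_norm D) (\<lambda>f z. mult_op D \<psi> f z - c * f z)" for c
  proof
    assume cl: "c \<in> closure (\<psi> ` D)"
    obtain S where S: "bounded_op_on X (bloch_norm D) S"
      "\<And>g. g \<in> X \<Longrightarrow> (\<lambda>z. mult_op D \<psi> (S g) z - c * S g z) = g"
      using inv unfolding invertible_on_def by blast
    have eq: "(\<psi> z - c) * S f z = f z" if "f \<in> X" "z \<in> D" for f z
      using fun_cong[OF S(2)[OF that(1)], of z] that(2) by (simp add: mult_op_def algebra_simps)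
    have one: "mult_op D (\<lambda>_. 1) (\<lambda>_. 1) \<in> X"
      using one_in_little_bloch X unfolding little_bloch_star_def by auto
    \<comment> \<open>At a zero of \<open>\<psi> - c\<close> every function in the range would
      vanish, but the constant \<open>1\<close> is in the range.\<close>
    have ne: "\<psi> z - c \<noteq> 0" if "z \<in> D" for z
      using eq[OF one that] that by (auto simp: mult_op_def)
    define g where "g = (\<lambda>z. inverse (\<psi> z - c))"
    have "S f = mult_op D g f" if f: "f \<in> X" for f
    proof
      fix z show "S f z = mult_op D g f z"
      proof (cases "z \<in> D")
        case True
        then show ?thesis
          using eq[OF f True] ne[OF True] by (simp add: mult_op_def g_def field_simps)
      next
        case False
        then show ?thesis
          using X0 S(1) f unfolding bounded_op_on_def by (auto simp: mult_op_def)
      qed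
    qed
    then have "bounded_op_on X (bloch_norm D) (mult_op D g)"
      using S(1) unfolding bounded_op_on_def by simp
    moreover have "holo D g"
      unfolding g_def using ne by (intro holo_inverse_shift[OF \<psi>]) force
    ultimately consider (b) "\<exists>C. \<forall>z\<in>D. cmod (g z) \<le> C" | (k) "g constant_on D"
      using multiplier_bounded_or_constant X by blast
    then have "\<exists>C. \<forall>z\<in>D. cmod (g z) \<le> C"
      by cases (auto simp: constant_on_def)
    then obtain C where C: "\<And>z. z \<in> D \<Longrightarrow> cmod (g z) \<le> C"
      by blast
    have C0: "0 < C"
      using C[OF \<open>0 \<in> D\<close>] ne[OF \<open>0 \<in> D\<close>] unfolding g_def
      by (metis nonzero_imp_inverse_nonzero less_le_trans zero_less_norm_iff)
    \<comment> \<open>A value of \<psi> closer to \<open>c\<close> than \<open>inverse C\<close>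
      would make \<open>|g|\<close> exceed \<open>C\<close>.\<close>
    obtain z where z: "z \<in> D" "dist (\<psi> z) c < inverse C"
      using cl C0 unfolding closure_approachable by (auto dest!: spec[of _ "inverse C"])
    have "inverse (cmod (\<psi> z - c)) \<le> C"
      using C[OF z(1)] by (simp add: g_def norm_inverse)
    then have "inverse C \<le> cmod (\<psi> z - c)"
      using C0 ne[OF z(1)] by (simp add: field_simps)
    then show False
      using z(2) by (simp add: dist_norm)
  qed
  ultimately show ?thesis
    unfolding spectrum_on_def by blast
qed

end

section \<open>Hilbert spaces of functions\<close>

text \<open>A carrier set rather than a type, so that the Bergman space of any open \<open>D\<close>
  can be an instance. Elements are functions, not classes, hence definiteness yields the zero
  function. Differences are written with \<open>+ - 1 *\<close> to fit the pattern
  \<open>f x + c * g x\<close> of \<open>comb_closed\<close> and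
  \<open>sqn_add_scale\<close>.\<close>

locale function_hilbert_space =
  fixes V :: "('a \<Rightarrow> complex) set" and ip :: "('a \<Rightarrow> complex) \<Rightarrow> ('a \<Rightarrow> complex) \<Rightarrow> complex"
  assumes zero_closed: "(\<lambda>_. 0) \<in> V"
    and add_closed: "f \<in> V \<Longrightarrow> g \<in> V \<Longrightarrow> (\<lambda>x. f x + g x) \<in> V"
    and scale_closed: "f \<in> V \<Longrightarrow> (\<lambda>x. c * f x) \<in> V"
    and ip_add: "f \<in> V \<Longrightarrow> g \<in> V \<Longrightarrow> h \<in> V \<Longrightarrow> ip (\<lambda>x. f x + g x) h = ip f h + ip g h"
    and ip_scale: "f \<in> V \<Longrightarrow> h \<in> V \<Longrightarrow> ip (\<lambda>x. c * f x) h = c * ip f h"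
    and ip_cnj: "f \<in> V \<Longrightarrow> h \<in> V \<Longrightarrow> cnj (ip f h) = ip h f"
    and ip_nonneg: "f \<in> V \<Longrightarrow> 0 \<le> Re (ip f f)"
    and ip_definite: "f \<in> V \<Longrightarrow> ip f f = 0 \<Longrightarrow> f = (\<lambda>_. 0)"
    and complete: "(\<And>n::nat. F n \<in> V) \<Longrightarrow>
      (\<And>e. e > 0 \<Longrightarrow> \<exists>N. \<forall>m\<ge>N. \<forall>n\<ge>N. Re (ip (\<lambda>x. F m x + - 1 * F n x) (\<lambda>x. F m x + - 1 * F n x)) < e) \<Longrightarrow>
      \<exists>f\<in>V. (\<lambda>n. Re (ip (\<lambda>x. F n x + - 1 * f x) (\<lambda>x. F n x + - 1 * f x))) \<longlonglongrightarrow> 0"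
begin

definition sqn :: "('a \<Rightarrow> complex) \<Rightarrow> real" where
  "sqn f = Re (ip f f)"

lemma ip_self: "f \<in> V \<Longrightarrow> ip f f = of_real (sqn f)"
  using ip_cnj[of f f] unfolding sqn_def by (simp add: complex_eq_iff)

lemma sqn_nonneg: "f \<in> V \<Longrightarrow> 0 \<le> sqn f"
  unfolding sqn_def by (rule ip_nonneg)

lemma sqn_eq_0: "f \<in> V \<Longrightarrow> sqn f = 0 \<Longrightarrow> f = (\<lambda>_. 0)"
  using ip_self ip_definite by simp

lemma ip_add_right:
  "f \<in> V \<Longrightarrow> g \<in> V \<Longrightarrow> h \<in> V \<Longrightarrow> ip h (\<lambda>x. f x + g x) = ip h f + ip h g"
  using ip_add[of f g h] ip_cnj add_closed by (metis complex_cnj_add)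

lemma ip_scale_right: "f \<in> V \<Longrightarrow> h \<in> V \<Longrightarrow> ip h (\<lambda>x. c * f x) = cnj c * ip h f"
  using ip_scale[of f h c] ip_cnj scale_closed by (metis complex_cnj_mult)

lemma comb_closed: "f \<in> V \<Longrightarrow> g \<in> V \<Longrightarrow> (\<lambda>x. f x + c * g x) \<in> V"
  by (rule add_closed, assumption, rule scale_closed)

lemma sqn_scale:
  assumes "f \<in> V"
  shows "sqn (\<lambda>x. c * f x) = (cmod c)\<^sup>2 * sqn f"
proof -
  have "ip (\<lambda>x. c * f x) (\<lambda>x. c * f x) = (c * cnj c) * ip f f"
    using ip_scale[OF assms scale_closed[OF assms], of c c] ip_scale_right[OF assms assms, of c] by simp
  also have "\<dots> = of_real ((cmod c)\<^sup>2 * sqn f)"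
    unfolding of_real_mult complex_norm_square ip_self[OF assms] ..
  finally show ?thesis
    by (simp add: sqn_def[of "\<lambda>x. c * f x"])
qed

lemma sqn_add_scale:
  assumes "f \<in> V" "g \<in> V"
  shows "sqn (\<lambda>x. f x + c * g x) = sqn f + 2 * Re (cnj c * ip f g) + (cmod c)\<^sup>2 * sqn g"
proof -
  note cl = assms scale_closed[OF assms(2)] comb_closed[OF assms]
  have "ip (\<lambda>x. f x + c * g x) (\<lambda>x. f x + c * g x)
      = ip f f + cnj c * ip f g + c * cnj (ip f g) + c * cnj c * ip g g"
    by (subst ip_add, fact, rule cl, rule cl, subst (1 2) ip_add_right, (rule cl)+,
        subst ip_scale, (rule cl)+, subst ip_scale, (rule cl)+, subst (1 2) ip_scale_right, (rule cl)+)
      (simp add: ip_cnj[OF assms] algebra_simps)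
  also have "c * cnj c = of_real ((cmod c)\<^sup>2)"
    by (rule complex_norm_square[symmetric])
  finally have *: "ip (\<lambda>x. f x + c * g x) (\<lambda>x. f x + c * g x)
      = of_real (sqn f) + cnj c * ip f g + c * cnj (ip f g) + of_real ((cmod c)\<^sup>2 * sqn g)"
    using ip_self[OF assms(1)] ip_self[OF assms(2)] by simp
  show ?thesis
    unfolding sqn_def[of "\<lambda>x. f x + c * g x"] * by simp
qed

lemma Cauchy_Schwarz:
  assumes f: "f \<in> V" and g: "g \<in> V"
  shows "(cmod (ip f g))\<^sup>2 \<le> sqn f * sqn g"
proof (cases "sqn g = 0")
  case True
  then have "(\<lambda>x. 0 * f x) = g"
    using sqn_eq_0[OF g] by simp
  then have "ip f g = 0"
    using ip_scale_right[OF f f, of 0] by simp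
  then show ?thesis
    using True by simp
next
  case False
  then have p: "0 < sqn g"
    using sqn_nonneg[OF g] by simp
  \<comment> \<open>The coefficient that minimises \<open>sqn (\<lambda>x. f x + c * g x)\<close>;
    that the minimum is nonnegative is the claimed inequality.\<close>
  define c where "c = - ip f g / of_real (sqn g)"
  have "0 \<le> sqn (\<lambda>x. f x + c * g x)"
    by (rule sqn_nonneg[OF comb_closed[OF f g]])
  also have "\<dots> = sqn f + 2 * Re (cnj c * ip f g) + (cmod c)\<^sup>2 * sqn g"
    by (rule sqn_add_scale[OF f g])
  also have "cnj c * ip f g = of_real (- (cmod (ip f g))\<^sup>2 / sqn g)"
    unfolding c_def using complex_norm_square[of "ip f g"] by (simp add: mult.commute)
  also have "cmod c = cmod (ip f g) / sqn g"
    unfolding c_def using p by (simp add: norm_divide)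
  finally show ?thesis
    using p by (simp add: power_divide field_simps power2_eq_square)
qed

text \<open>The representing vector is a multiple of the element of least norm in \<open>{f. l f = 1}\<close>.\<close>

theorem Riesz_representation:
  assumes add: "\<And>f g. f \<in> V \<Longrightarrow> g \<in> V \<Longrightarrow> l (\<lambda>x. f x + g x) = l f + l g"
    and scale: "\<And>f c. f \<in> V \<Longrightarrow> l (\<lambda>x. c * f x) = c * l f"
    and bound: "\<And>f. f \<in> V \<Longrightarrow> (cmod (l f))\<^sup>2 \<le> C * sqn f"
  shows "\<exists>g\<in>V. \<forall>f\<in>V. l f = ip f g"
proof (cases "\<forall>f\<in>V. l f = 0")
  case True
  have "ip f (\<lambda>_. 0) = 0" if "f \<in> V" for f
    using ip_scale_right[OF that that, of 0] by simp
  then show ?thesis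
    using True zero_closed by force
next
  case False
  define A where "A = {f \<in> V. l f = 1}"
  obtain p where p: "p \<in> V" "l p \<noteq> 0"
    using False by blast
  have "(\<lambda>x. inverse (l p) * p x) \<in> A"
    unfolding A_def using p scale_closed[OF p(1)] scale[OF p(1)] by simp
  then have A: "A \<noteq> {}"
    by blast
  define d where "d = Inf (sqn ` A)"
  have bdd: "bdd_below (sqn ` A)"
    using sqn_nonneg unfolding A_def by (auto intro!: bdd_belowI[of _ 0])
  have dle: "d \<le> sqn f" if "f \<in> V" "l f = 1" for f
    unfolding d_def using that by (intro cInf_lower bdd) (auto simp: A_def)
  have "\<exists>f\<in>A. sqn f < d + 1 / real (Suc n)" for n
    using cInf_lessD[of "sqn ` A" "d + 1 / real (Suc n)"] A unfolding d_def by auto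
  then obtain F where F: "\<And>n. F n \<in> V" "\<And>n. l (F n) = 1" "\<And>n. sqn (F n) < d + 1 / real (Suc n)"
    unfolding A_def by (metis (mono_tags, lifting) mem_Collect_eq)
  \<comment> \<open>The midpoint of two competitors is again a competitor, so its \<open>sqn\<close>
    is at least \<open>d\<close>; the parallelogram law then bounds the distance by the excess of
    both over the infimum.\<close>
  have mid: "sqn (\<lambda>x. F m x + - 1 * F n x) < 2 / real (Suc m) + 2 / real (Suc n)" for m n
  proof -
    let ?h = "\<lambda>x. (1/2) * (F m x + 1 * F n x)"
    have "l (\<lambda>x. F m x + 1 * F n x) = 2"
      using add[OF F(1) F(1), of m n] F(2) by simp
    then have "l ?h = 1" "?h \<in> V"
      using scale[OF comb_closed[OF F(1) F(1)], of "1/2" m 1 n]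
        scale_closed[OF comb_closed[OF F(1) F(1)], of "1/2" m 1 n] by auto
    then have "d \<le> sqn ?h"
      using dle by blast
    also have "sqn ?h = 1/4 * sqn (\<lambda>x. F m x + 1 * F n x)"
      using sqn_scale[OF comb_closed[OF F(1) F(1)], of "1/2" m 1 n] by (simp add: power2_eq_square norm_divide)
    finally have "4 * d \<le> sqn (\<lambda>x. F m x + 1 * F n x)"
      by simp
    moreover have "sqn (\<lambda>x. F m x + 1 * F n x) + sqn (\<lambda>x. F m x + - 1 * F n x) = 2 * sqn (F m) + 2 * sqn (F n)"
      using sqn_add_scale[OF F(1) F(1), of m 1 n] sqn_add_scale[OF F(1) F(1), of m "-1" n] by simp
    ultimately show ?thesis
      using F(3)[of m] F(3)[of n] by simp
  qed
  have "\<exists>f\<in>V. (\<lambda>n. Re (ip (\<lambda>x. F n x + - 1 * f x) (\<lambda>x. F n x + - 1 * f x))) \<longlonglongrightarrow> 0"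
  proof (rule complete[OF F(1)])
    fix e :: real assume e: "e > 0"
    obtain N where N: "4 / e < real N"
      using reals_Archimedean2 by blast
    have "2 / real (Suc k) < e / 2" if "k \<ge> N" for k
    proof -
      have "4 / e < real (Suc k)"
        using N that by linarith
      then show ?thesis
        using e by (simp add: field_simps)
    qed
    then have "sqn (\<lambda>x. F m x + - 1 * F n x) < e" if "m \<ge> N" "n \<ge> N" for m n
      using mid[of m n] that by (smt (verit) field_sum_of_halves)
    then show "\<exists>N. \<forall>m\<ge>N. \<forall>n\<ge>N. Re (ip (\<lambda>x. F m x + - 1 * F n x) (\<lambda>x. F m x + - 1 * F n x)) < e"
      unfolding sqn_def by blast
  qed
  then obtain f where f: "f \<in> V" and lim: "(\<lambda>n. sqn (\<lambda>x. F n x + - 1 * f x)) \<longlonglongrightarrow> 0"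
    unfolding sqn_def by blast
  have G: "(\<lambda>x. F n x + - 1 * f x) \<in> V" for n
    by (rule comb_closed[OF F(1) f])
  have l0: "l (\<lambda>x. F n x + - 1 * f x) = 1 - l f" for n
    using add[OF F(1) scale_closed[OF f], of n "-1"] scale[OF f, of "-1"] F(2) by simp
  \<comment> \<open>The bound on \<open>l\<close> makes it continuous, so the constraint passes to
    the limit.\<close>
  have lf: "l f = 1"
  proof -
    have "(\<lambda>n. C * sqn (\<lambda>x. F n x + - 1 * f x)) \<longlonglongrightarrow> C * 0"
      by (intro tendsto_intros lim)
    moreover have "(cmod (1 - l f))\<^sup>2 \<le> C * sqn (\<lambda>x. F n x + - 1 * f x)" for n
      using bound[OF G] l0 by metis
    ultimately have "(cmod (1 - l f))\<^sup>2 \<le> C * 0"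
      by (intro LIMSEQ_le_const) auto
    then show ?thesis
      by simp
  qed
  have sf: "sqn f = d"
  proof (rule antisym)
    show "d \<le> sqn f"
      using dle[OF f lf] .
    text \<open>\<open>sqn f = sqn F - 2 Re (F, F - f) + sqn (F - f)\<close>, and the middle term is controlled by Cauchy-Schwarz.\<close>
    define s where "s n = sqn (\<lambda>x. F n x + - 1 * f x)" for n
    have s0: "0 \<le> s n" for n
      unfolding s_def by (rule sqn_nonneg[OF G])
    have "sqn f \<le> (d + 1 / real (Suc n)) + 2 * sqrt ((d + 1) * s n) + s n" for n
    proof -
      let ?g = "\<lambda>x. F n x + - 1 * f x"
      have "(\<lambda>x. F n x + - 1 * ?g x) = f"
        by auto
      then have "sqn f = sqn (F n) + 2 * Re (cnj (- 1) * ip (F n) ?g) + s n"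
        using sqn_add_scale[OF F(1) G, of n "-1" n] unfolding s_def by simp
      moreover have "(cmod (ip (F n) ?g))\<^sup>2 \<le> (d + 1) * s n"
      proof -
        have "1 / real (Suc n) \<le> 1"
          by simp
        then have "sqn (F n) \<le> d + 1"
          using F(3)[of n] by linarith
        then show ?thesis
          using Cauchy_Schwarz[OF F(1) G, of n n] mult_right_mono[OF _ s0[of n]]
          unfolding s_def by (meson order_trans)
      qed
      then have "cmod (ip (F n) ?g) \<le> sqrt ((d + 1) * s n)"
        by (rule real_le_rsqrt)
      then have "Re (cnj (- 1) * ip (F n) ?g) \<le> sqrt ((d + 1) * s n)"
        using complex_Re_le_cmod[of "cnj (- 1) * ip (F n) ?g"] by (simp add: norm_mult)
      ultimately show ?thesis
        using F(3)[of n] by linarith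
    qed
    moreover have "(\<lambda>n. (d + 1 / real (Suc n)) + 2 * sqrt ((d + 1) * s n) + s n)
      \<longlonglongrightarrow> (d + 0) + 2 * sqrt ((d + 1) * 0) + 0"
      unfolding s_def by (intro tendsto_intros lim LIMSEQ_Suc[OF lim_1_over_n])
    ultimately show "sqn f \<le> d"
      by (intro LIMSEQ_le_const[of "\<lambda>n. (d + 1 / real (Suc n)) + 2 * sqrt ((d + 1) * s n) + s n"]) auto
  qed
  have dpos: "0 < d"
  proof (rule ccontr)
    assume "\<not> 0 < d"
    then have "f = (\<lambda>_. 0)"
      using sf sqn_nonneg[OF f] sqn_eq_0[OF f] by simp
    then have "l f = 0"
      using scale[OF f, of 0] by simp
    then show False
      using lf by simp
  qed
  \<comment> \<open>Moving the minimiser along the kernel of \<open>l\<close> keeps the constraint;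
    minimality against the best coefficient forces orthogonality.\<close>
  have orth: "ip f h = 0" if h: "h \<in> V" "l h = 0" for h
  proof (cases "sqn h = 0")
    case True
    then show ?thesis
      using Cauchy_Schwarz[OF f h(1)] by simp
  next
    case False
    then have p: "0 < sqn h"
      using sqn_nonneg[OF h(1)] by simp
    define c where "c = - ip f h / of_real (sqn h)"
    have "l (\<lambda>x. f x + c * h x) = 1"
      using add[OF f scale_closed[OF h(1)]] scale[OF h(1)] lf h(2) by simp
    then have "d \<le> sqn (\<lambda>x. f x + c * h x)"
      using dle comb_closed[OF f h(1)] by blast
    also have "\<dots> = sqn f + 2 * Re (cnj c * ip f h) + (cmod c)\<^sup>2 * sqn h"
      by (rule sqn_add_scale[OF f h(1)])
    also have "cnj c * ip f h = of_real (- (cmod (ip f h))\<^sup>2 / sqn h)"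
      unfolding c_def using complex_norm_square[of "ip f h"] by (simp add: mult.commute)
    also have "cmod c = cmod (ip f h) / sqn h"
      unfolding c_def using p by (simp add: norm_divide)
    finally have "(cmod (ip f h))\<^sup>2 \<le> 0"
      using p sf by (simp add: power_divide field_simps power2_eq_square)
    then show ?thesis
      by simp
  qed
  \<comment> \<open>Subtracting \<open>l h * f\<close> puts \<open>h\<close> into the kernel of
    \<open>l\<close>; the factor \<open>1 / d\<close> compensates for
    \<open>ip f f = d\<close>.\<close>
  have "l h = ip h (\<lambda>x. of_real (1 / d) * f x)" if h: "h \<in> V" for h
  proof -
    let ?k = "\<lambda>x. h x + - l h * f x"
    have k: "?k \<in> V" "l ?k = 0"
      using comb_closed[OF h f, of "- l h"] add[OF h scale_closed[OF f], of "- l h"] scale[OF f, of "- l h"] lf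
      by auto
    then have "ip ?k f = 0"
      using orth ip_cnj[OF f k(1)] by fastforce
    moreover have "ip ?k f = ip h f - l h * d"
      using ip_add[OF h scale_closed[OF f] f, of "- l h"] ip_scale[OF f f, of "- l h"] ip_self[OF f] sf by simp
    ultimately have "ip h f = l h * d"
      by simp
    moreover have "ip h (\<lambda>x. of_real (1 / d) * f x) = of_real (1 / d) * ip h f"
      using ip_scale_right[OF f h, of "of_real (1 / d)"] by (simp only: complex_cnj_complex_of_real)
    ultimately show ?thesis
      using dpos by simp
  qed
  then show ?thesis
    using scale_closed[OF f, of "of_real (1 / d)"] by blast
qed

text \<open>Equality would mean that \<open>g\<close> is a multiple of \<open>f\<close>. The vector
  \<open>h\<close> excludes this, being orthogonal to \<open>f\<close> but not to
  \<open>g\<close>.\<close>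

lemma Cauchy_Schwarz_strict:
  assumes f: "f \<in> V" and g: "g \<in> V" and h: "h \<in> V" "ip h f = 0" "ip h g \<noteq> 0" and f0: "sqn f \<noteq> 0"
  shows "(cmod (ip f g))\<^sup>2 < sqn f * sqn g"
proof -
  have p: "0 < sqn f"
    using f0 sqn_nonneg[OF f] by simp
  define c where "c = - ip g f / of_real (sqn f)"
  let ?v = "\<lambda>x. g x + c * f x"
  have v: "?v \<in> V"
    by (rule comb_closed[OF g f])
  have "ip h ?v \<noteq> 0"
    using ip_add_right[OF g scale_closed[OF f] h(1)] ip_scale_right[OF f h(1)] h by simp
  then have "sqn ?v \<noteq> 0"
    using Cauchy_Schwarz[OF h(1) v] by auto
  then have "0 < sqn ?v"
    using sqn_nonneg[OF v] by simp
  also have "sqn ?v = sqn g + 2 * Re (cnj c * ip g f) + (cmod c)\<^sup>2 * sqn f"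
    by (rule sqn_add_scale[OF g f])
  also have "cnj c * ip g f = of_real (- (cmod (ip g f))\<^sup>2 / sqn f)"
    unfolding c_def using complex_norm_square[of "ip g f"] by (simp add: mult.commute)
  also have "cmod c = cmod (ip g f) / sqn f"
    unfolding c_def using p by (simp add: norm_divide)
  also have "cmod (ip g f) = cmod (ip f g)"
    using ip_cnj[OF f g] by (metis complex_mod_cnj)
  finally show ?thesis
    using p by (simp add: power_divide field_simps power2_eq_square)
qed

end

section \<open>Mean value inequality\<close>

text \<open>Both sides, multiplied by the volume of the unit ball \<open>B\<close>, are the integral of
  \<open>1_B(y) 1_A(f x + y)\<close> over all \<open>(x, y)\<close>, evaluated in the two orders.\<close>

lemma lborel_distr_linear_isometry:
  fixes f :: "'a::euclidean_space \<Rightarrow> 'a"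
  assumes f: "linear f" and iso: "\<And>x. norm (f x) = norm x"
  shows "distr lborel borel f = (lborel :: 'a measure)"
proof (rule measure_eqI)
  show "sets (distr lborel borel f) = sets (lborel :: 'a measure)"
    by simp
  fix A assume "A \<in> sets (distr lborel borel f)"
  then have A [measurable]: "A \<in> sets borel"
    by simp
  have cf: "continuous_on UNIV f"
    using linear_continuous_on[of f UNIV] f linear_conv_bounded_linear by blast
  have f_meas [measurable]: "f \<in> borel_measurable borel"
    using cf by (rule borel_measurable_continuous_onI)
  have "inj f"
    using f iso by (metis linear_injective_0 norm_eq_zero)
  then have surj: "surj f"
    using f linear_injective_imp_surjective by blast
  define B where "B = ball (0::'a) 1"
  have B [measurable]: "B \<in> sets borel"
    unfolding B_def by simp
  have m [measurable]: "(\<lambda>p. f (fst p) + snd p) \<in> borel_measurable (lborel \<Otimes>\<^sub>M lborel)"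
    "(\<lambda>p. snd p - f (fst p)) \<in> borel_measurable (lborel \<Otimes>\<^sub>M lborel)"
    by measurable
  have transl: "(\<integral>\<^sup>+x. h (x + c) \<partial>lborel) = (\<integral>\<^sup>+x. h x \<partial>lborel)"
    if [measurable]: "h \<in> borel_measurable borel" for h :: "'a \<Rightarrow> ennreal" and c
    using nn_integral_distr[of "(+) c" lborel borel h] lborel_distr_plus[of c]
    by (simp add: add.commute)
  have 1: "(\<integral>\<^sup>+x. indicator A (f x + y) \<partial>lborel) = emeasure (distr lborel borel f) A" for y
  proof -
    \<comment> \<open>Surjectivity turns a shift by \<open>y\<close> in the target into a shift by
      \<open>w\<close> in the source, under which \<open>lborel\<close> is invariant.\<close>
    obtain w where w: "y = f w"
      using surj by blast
    have "(\<integral>\<^sup>+x. indicator A (f x + y) \<partial>lborel) = (\<integral>\<^sup>+x. indicator A (f (x + w)) \<partial>lborel)"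
      unfolding w linear_add[OF f] ..
    also have "\<dots> = (\<integral>\<^sup>+x. indicator A (f x) \<partial>lborel)"
      using transl[of "\<lambda>x. indicator A (f x)" w] by simp
    also have "\<dots> = emeasure (distr lborel borel f) A"
      using nn_integral_distr[of f lborel borel "indicator A"] by simp
    finally show ?thesis .
  qed
  have 2: "(\<integral>\<^sup>+x. indicator B (y - f x) \<partial>lborel) = emeasure lborel B" for y
  proof -
    obtain w where w: "y = f w"
      using surj by blast
    have "y - f x \<in> B \<longleftrightarrow> x \<in> ball w 1" for x
      unfolding w linear_diff[OF f, symmetric] B_def by (simp add: iso dist_norm)
    then have "(\<integral>\<^sup>+x. indicator B (y - f x) \<partial>lborel) = (\<integral>\<^sup>+x. indicator (ball w 1) x \<partial>lborel)"
      by (intro nn_integral_cong) (simp add: indicator_def)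
    then show ?thesis
      unfolding B_def by (simp add: emeasure_ball)
  qed
  have "emeasure (distr lborel borel f) A * emeasure lborel B
      = (\<integral>\<^sup>+y. emeasure (distr lborel borel f) A * indicator B y \<partial>lborel)"
    by (simp add: nn_integral_cmult)
  also have "\<dots> = (\<integral>\<^sup>+y. \<integral>\<^sup>+x. indicator A (f x + y) * indicator B y \<partial>lborel \<partial>lborel)"
    using 1 by (simp add: nn_integral_multc)
  also have "\<dots> = (\<integral>\<^sup>+x. \<integral>\<^sup>+y. indicator A (f x + y) * indicator B y \<partial>lborel \<partial>lborel)"
    by (rule lborel_pair.Fubini') (simp add: case_prod_beta')
  also have "\<dots> = (\<integral>\<^sup>+x. \<integral>\<^sup>+y. indicator A y * indicator B (y - f x) \<partial>lborel \<partial>lborel)"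
  proof (rule nn_integral_cong)
    fix x
    show "(\<integral>\<^sup>+y. indicator A (f x + y) * indicator B y \<partial>lborel)
        = (\<integral>\<^sup>+y. indicator A y * indicator B (y - f x) \<partial>lborel)"
      using transl[of "\<lambda>y. indicator A y * indicator B (y - f x)" "f x"] by (simp add: add.commute)
  qed
  also have "\<dots> = (\<integral>\<^sup>+y. \<integral>\<^sup>+x. indicator A y * indicator B (y - f x) \<partial>lborel \<partial>lborel)"
    by (rule lborel_pair.Fubini'[symmetric]) (simp add: case_prod_beta')
  also have "\<dots> = emeasure lborel A * emeasure lborel B"
    by (simp add: nn_integral_cmult nn_integral_multc 2)
  finally have "emeasure (distr lborel borel f) A * emeasure lborel B = emeasure lborel A * emeasure lborel B" .
  moreover have "emeasure lborel B \<noteq> top" "emeasure lborel B \<noteq> 0"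
    using emeasure_lborel_ball_finite[of "0::'a" 1] unit_ball_vol_pos[of "real DIM('a)"]
    unfolding B_def by (auto simp: emeasure_ball ennreal_eq_0_iff simp del: unit_ball_vol_pos)
  ultimately show "emeasure (distr lborel borel f) A = emeasure lborel A"
    by (metis mult_divide_eq_ennreal)
qed

section \<open>Rotations, complex lines, and averages over circles and balls\<close>

lemma norm_vector_scale: "norm (c *s v) = cmod c * norm (v :: complex ^ 'n)"
  unfolding norm_vec_def by (simp add: norm_mult L2_set_right_distrib)

lemma vector_scale_continuous [continuous_intros]:
  fixes g :: "'a::topological_space \<Rightarrow> complex ^ 'n"
  assumes "continuous_on S f" "continuous_on S g"
  shows "continuous_on S (\<lambda>x. f x *s g x)"
  unfolding vector_scalar_mult_def by (intro continuous_intros assms)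

lemma vector_scaleR_scale: "r *\<^sub>R v = of_real r *s (v :: complex ^ 'n)"
  by (simp add: vec_eq_iff complex_eq_iff)

text \<open>Multiplication by a unimodular scalar is a real-linear isometry of
  \<open>complex ^ 'n\<close>.\<close>

lemma nn_integral_rotation:
  fixes h :: "complex ^ 'n \<Rightarrow> ennreal"
  assumes [measurable]: "h \<in> borel_measurable borel" and "cmod c = 1"
  shows "(\<integral>\<^sup>+v. h (c *s v) \<partial>lborel) = (\<integral>\<^sup>+v. h v \<partial>lborel)"
proof -
  have "linear ((*s) c :: complex ^ 'n \<Rightarrow> complex ^ 'n)"
    by (rule linearI) (simp_all add: vec_eq_iff algebra_simps)
  then have "distr lborel borel ((*s) c) = (lborel :: (complex ^ 'n) measure)"
    by (rule lborel_distr_linear_isometry) (simp add: norm_vector_scale assms(2))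
  moreover have "(\<lambda>v :: complex ^ 'n. c *s v) \<in> borel_measurable borel"
    by (intro borel_measurable_continuous_onI continuous_intros)
  ultimately show ?thesis
    using nn_integral_distr[of "(*s) c" lborel borel h] by simp
qed

text \<open>Cauchy's formula for the holomorphic function \<open>g\<^sup>2\<close> represents
  \<open>(g 0)\<^sup>2\<close> as a circle average; the modulus is then moved inside the
  integral.\<close>

lemma sub_mean_value_circle:
  assumes g: "g holomorphic_on cball 0 1"
  shows "ennreal ((cmod (g 0))\<^sup>2) \<le> (\<integral>\<^sup>+t. ennreal ((cmod (g (cis (2 * pi * t))))\<^sup>2) * indicator {0..1} t \<partial>lborel)"
proof -
  define h where "h t = (g (cis (2 * pi * t)))\<^sup>2" for t :: real
  have "((\<lambda>u. (g u)\<^sup>2 / (u - 0)) has_contour_integral 2 * of_real pi * \<i> * (g 0)\<^sup>2) (circlepath 0 1)"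
    by (rule Cauchy_integral_circlepath_simple) (auto intro!: holomorphic_intros g)
  moreover have "circlepath 0 1 t = cis (2 * pi * t)" for t
    by (simp add: circlepath cis_conv_exp mult_ac)
  ultimately have "((\<lambda>t. (g (cis (2 * pi * t)))\<^sup>2 / cis (2 * pi * t) * (2 * pi * \<i> * cis (2 * pi * t)))
      has_integral 2 * of_real pi * \<i> * (g 0)\<^sup>2) {0..1}"
    unfolding has_contour_integral
    by (subst (asm) has_integral_cong[where g = "\<lambda>t. (g (cis (2 * pi * t)))\<^sup>2 / cis (2 * pi * t) * (2 * pi * \<i> * cis (2 * pi * t))"])
      (auto simp: vector_derivative_circlepath cis_conv_exp mult_ac)
  from has_integral_mult_right[OF this, of "inverse (2 * of_real pi * \<i>)"]
  have I: "(h has_integral (g 0)\<^sup>2) {0..1}"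
    unfolding h_def by (simp add: field_simps)
  have "continuous_on {0..1} (\<lambda>t::real. g (cis (2 * pi * t)))"
    by (rule continuous_on_compose2[OF holomorphic_on_imp_continuous_on[OF g]])
      (auto intro!: continuous_intros)
  then have "continuous_on {0..1} h"
    unfolding h_def by (intro continuous_intros)
  then have "(\<lambda>t. cmod (h t)) integrable_on {0..1}"
    by (intro integrable_continuous_real continuous_intros)
  moreover have "norm (integral {0..1} h) \<le> integral {0..1} (\<lambda>t. cmod (h t))"
    using I calculation by (intro integral_norm_bound_integral) auto
  ultimately have "(cmod (g 0))\<^sup>2 \<le> integral {0..1} (\<lambda>t. cmod (h t))"
    "((\<lambda>t. cmod (h t)) has_integral integral {0..1} (\<lambda>t. cmod (h t))) {0..1}"
    using integral_unique[OF I] by (auto simp: norm_power)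
  then have "ennreal ((cmod (g 0))\<^sup>2) \<le> ennreal (integral {0..1} (\<lambda>t. cmod (h t)))"
    by (simp add: ennreal_leI)
  also have "\<dots> = (\<integral>\<^sup>+t. ennreal (cmod (h t)) * indicator {0..1} t \<partial>lborel)"
    by (rule nn_integral_has_integral_lebesgue'[symmetric]) (simp, fact)
  finally show ?thesis
    unfolding h_def norm_power .
qed

text \<open>Complex homogeneity of the derivative in \<open>holo\<close> turns the real derivative
  along a complex line into a complex one. This is the bridge to one-variable theory.\<close>

lemma holo_line_derivative:
  fixes z u :: "complex ^ 'n"
  assumes "holo D f" "z + \<zeta> *s u \<in> D"
  shows "((\<lambda>\<zeta>. f (z + \<zeta> *s u)) has_field_derivative frechet_derivative f (at (z + \<zeta> *s u)) u) (at \<zeta>)"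
proof -
  have "bounded_linear (\<lambda>\<zeta>. \<zeta> *s u)"
  proof (rule bounded_linear_intro[where K = "norm u"])
    show "(r *\<^sub>R x) *s u = r *\<^sub>R (x *s u)" for r x
      by (simp add: vec_eq_iff)
  qed (simp_all add: vec_eq_iff distrib_right norm_vector_scale)
  then have "((\<lambda>\<zeta>. z + \<zeta> *s u) has_derivative (\<lambda>\<eta>. 0 + \<eta> *s u)) (at \<zeta>)"
    by (intro has_derivative_add has_derivative_const bounded_linear_imp_has_derivative)
  from has_derivative_compose[OF this holo_has_derivative[OF assms]]
  have "((\<lambda>\<zeta>. f (z + \<zeta> *s u)) has_derivative (\<lambda>\<eta>. \<eta> * frechet_derivative f (at (z + \<zeta> *s u)) u)) (at \<zeta>)"
    using holo_derivative_scale[OF assms] by simp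
  moreover have "(\<lambda>\<eta>. \<eta> * frechet_derivative f (at (z + \<zeta> *s u)) u) = (*) (frechet_derivative f (at (z + \<zeta> *s u)) u)"
    by (auto simp: mult.commute)
  ultimately show ?thesis
    unfolding has_field_derivative_def by simp
qed

lemma holo_line:
  assumes "holo D f" "\<And>\<zeta>. \<zeta> \<in> S \<Longrightarrow> z + \<zeta> *s u \<in> D"
  shows "(\<lambda>\<zeta>. f (z + \<zeta> *s u)) holomorphic_on S"
  using holo_line_derivative assms
  by (metis field_differentiable_at_within field_differentiable_def holomorphic_on_def)

lemma holo_continuous_on: "holo D f \<Longrightarrow> continuous_on D f"
  by (rule has_derivative_continuous_on, rule has_derivative_at_withinI, rule holo_has_derivative)

text \<open>The circle inequality for \<open>\<lambda>\<zeta>. f (w + \<zeta> *s v)\<close> is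
  integrated over all \<open>v\<close> in the ball, and the order of integration is
  exchanged.\<close>

lemma holo_sub_mean_value:
  fixes w :: "complex ^ 'n"
  assumes f: "holo D f" and ball: "ball w r \<subseteq> D"
  shows "ennreal ((cmod (f w))\<^sup>2) * emeasure lborel (ball w r)
    \<le> (\<integral>\<^sup>+z. ennreal ((cmod (f z))\<^sup>2) * indicator (ball w r) z \<partial>lborel)"
proof -
  \<comment> \<open>The cutoff gives a function measurable on the whole space, although
    \<open>f\<close> is controlled only on \<open>D\<close>.\<close>
  define h where "h z = ennreal ((cmod (f z))\<^sup>2) * indicator (ball w r) z" for z
  define k where "k v = h (w + v)" for v
  have "continuous_on (ball w r) (\<lambda>z. (cmod (f z))\<^sup>2)"
    using holo_continuous_on[OF f] ball by (intro continuous_intros) (rule continuous_on_subset)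
  then have "(\<lambda>z. indicator (ball w r) z *\<^sub>R (cmod (f z))\<^sup>2) \<in> borel_measurable borel"
    by (intro borel_measurable_continuous_on_indicator) auto
  then have "(\<lambda>z. ennreal (indicator (ball w r) z *\<^sub>R (cmod (f z))\<^sup>2)) \<in> borel_measurable borel"
    by measurable
  moreover have "(\<lambda>z. ennreal (indicator (ball w r) z *\<^sub>R (cmod (f z))\<^sup>2)) = h"
    unfolding h_def by (auto simp: indicator_def)
  ultimately have h [measurable]: "h \<in> borel_measurable borel"
    by (simp only:)
  have k [measurable]: "k \<in> borel_measurable borel"
    unfolding k_def by measurable
  have "(\<lambda>p :: real \<times> (complex ^ 'n). cis (2 * pi * fst p) *s snd p) \<in> borel_measurable borel"
    by (intro borel_measurable_continuous_onI continuous_intros)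
  then have rot [measurable]: "(\<lambda>p :: real \<times> (complex ^ 'n). cis (2 * pi * fst p) *s snd p)
      \<in> borel_measurable (lborel \<Otimes>\<^sub>M lborel)"
    by (simp add: lborel_prod)
  have kp: "(\<lambda>p. k (cis (2 * pi * fst p) *s snd p)) \<in> borel_measurable (lborel \<Otimes>\<^sub>M lborel)"
    using measurable_compose[OF rot k] .
  have transl: "(\<integral>\<^sup>+v. H (w + v) \<partial>lborel) = (\<integral>\<^sup>+v. H v \<partial>lborel)"
    if [measurable]: "H \<in> borel_measurable borel" for H :: "complex ^ 'n \<Rightarrow> ennreal"
    using nn_integral_distr[of "(+) w" lborel borel H] lborel_distr_plus[of w] by simp
  have circ: "ennreal ((cmod (f w))\<^sup>2) * indicator (ball w r) (w + v)
      \<le> (\<integral>\<^sup>+t. k (cis (2 * pi * t) *s v) * indicator {0..1} t \<partial>lborel)" for v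
  proof (cases "w + v \<in> ball w r")
    case True
    then have v: "norm v < r"
      by (simp add: dist_norm)
    have in_ball: "w + \<zeta> *s v \<in> ball w r" if "cmod \<zeta> \<le> 1" for \<zeta>
    proof -
      have "cmod \<zeta> * norm v \<le> 1 * norm v"
        using that by (intro mult_right_mono) auto
      then show ?thesis
        using v by (simp add: dist_norm norm_vector_scale)
    qed
    have "ennreal ((cmod (f (w + 0 *s v)))\<^sup>2) \<le>
        (\<integral>\<^sup>+t. ennreal ((cmod (f (w + cis (2 * pi * t) *s v)))\<^sup>2) * indicator {0..1} t \<partial>lborel)"
      by (rule sub_mean_value_circle[OF holo_line[OF f]]) (simp add: subsetD[OF ball in_ball])
    also have "\<dots> = (\<integral>\<^sup>+t. k (cis (2 * pi * t) *s v) * indicator {0..1} t \<partial>lborel)"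
      unfolding k_def h_def using in_ball by (intro nn_integral_cong) simp
    finally show ?thesis
      using True by simp
  qed simp
  have "ennreal ((cmod (f w))\<^sup>2) * emeasure lborel (ball w r)
      = (\<integral>\<^sup>+v. ennreal ((cmod (f w))\<^sup>2) * indicator (ball w r) v \<partial>lborel)"
    by (rule nn_integral_cmult_indicator[symmetric]) simp
  also have "\<dots> = (\<integral>\<^sup>+v. ennreal ((cmod (f w))\<^sup>2) * indicator (ball w r) (w + v) \<partial>lborel)"
  proof (rule transl[symmetric])
    have [measurable]: "ball w r \<in> sets borel"
      by simp
    show "(\<lambda>v. ennreal ((cmod (f w))\<^sup>2) * indicator (ball w r) v) \<in> borel_measurable borel"
      by measurable
  qed
  also have "\<dots> \<le> (\<integral>\<^sup>+v. \<integral>\<^sup>+t. k (cis (2 * pi * t) *s v) * indicator {0..1} t \<partial>lborel \<partial>lborel)"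
    by (intro nn_integral_mono circ)
  also have "\<dots> = (\<integral>\<^sup>+t. \<integral>\<^sup>+v. k (cis (2 * pi * t) *s v) * indicator {0..1} t \<partial>lborel \<partial>lborel)"
    by (rule lborel_pair.Fubini') (use kp in \<open>simp add: case_prod_beta'\<close>)
  \<comment> \<open>For fixed \<open>t\<close>, rotation invariance removes \<open>t\<close> from
    the inner integral, and the parameter interval has length 1.\<close>
  also have "\<dots> = (\<integral>\<^sup>+t. (\<integral>\<^sup>+v. k v \<partial>lborel) * indicator {0..1::real} t \<partial>lborel)"
  proof (rule nn_integral_cong)
    fix t :: real
    have "(\<lambda>v :: complex ^ 'n. cis (2 * pi * t) *s v) \<in> borel_measurable borel"
      by (intro borel_measurable_continuous_onI continuous_intros)
    then have [measurable]: "(\<lambda>v. k (cis (2 * pi * t) *s v)) \<in> borel_measurable borel"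
      using k by (rule measurable_compose)
    show "(\<integral>\<^sup>+v. k (cis (2 * pi * t) *s v) * indicator {0..1} t \<partial>lborel)
        = (\<integral>\<^sup>+v. k v \<partial>lborel) * indicator {0..1} t"
      using nn_integral_rotation[OF k, of "cis (2 * pi * t)"] by (simp add: nn_integral_multc)
  qed
  also have "\<dots> = (\<integral>\<^sup>+v. k v \<partial>lborel)"
    by (simp add: nn_integral_cmult)
  also have "\<dots> = (\<integral>\<^sup>+z. h z \<partial>lborel)"
    unfolding k_def by (rule transl[OF h])
  finally show ?thesis
    unfolding h_def .
qed

section \<open>Logarithms of power series in one real variable\<close>

text \<open>The first derivative is provided on a whole interval, since an iterated
  \<open>deriv\<close> at \<open>0\<close> depends on it near \<open>0\<close>.\<close>

lemma second_derivative_power_series: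
  fixes p :: "real \<Rightarrow> real"
  assumes r: "0 < r" and p: "\<And>t. \<bar>t\<bar> < r \<Longrightarrow> (\<lambda>n. c n * t ^ n) sums p t"
  shows "\<exists>p'. (\<forall>t. \<bar>t\<bar> < r \<longrightarrow> (p has_real_derivative p' t) (at t)) \<and> p' 0 = c 1 \<and>
    (p' has_real_derivative 2 * c 2) (at 0)"
proof -
  define F where "F = Abs_fps c"
  have "ereal r \<le> conv_radius c"
  proof (rule conv_radius_geI_ex')
    fix s :: real assume "0 < s" "ereal s < ereal r"
    then show "summable (\<lambda>n. c n * of_real s ^ n)"
      using p[of s] by (auto simp: sums_iff)
  qed
  then have rF: "ereal r \<le> fps_conv_radius F"
    unfolding F_def fps_conv_radius_def by simp
  have "ereal \<bar>t\<bar> < fps_conv_radius F" if "\<bar>t\<bar> < r" for t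
    using that rF by (meson ereal_less(2) less_ereal.simps(1) less_le_trans)
  then have radF: "ereal (norm t) < fps_conv_radius F" if "\<bar>t\<bar> < r" for t
    using that by simp
  then have radF': "ereal (norm t) < fps_conv_radius (fps_deriv F)" if "\<bar>t\<bar> < r" for t
    using that fps_conv_radius_deriv[of F] by (meson less_le_trans)
  have eq: "eval_fps F t = p t" if "\<bar>t\<bar> < r" for t
    using p[OF that] unfolding eval_fps_def F_def by (simp add: sums_iff)
  have 1: "(p has_real_derivative eval_fps (fps_deriv F) t) (at t)" if t: "\<bar>t\<bar> < r" for t
  proof (rule has_field_derivative_transform_within_open[of "eval_fps F" _ _ "{-r<..<r}"])
    show "(eval_fps F has_real_derivative eval_fps (fps_deriv F) t) (at t)"
      by (rule has_field_derivative_eval_fps) (rule radF[OF t])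
  qed (use t eq in \<open>auto simp: abs_less_iff\<close>)
  have "(eval_fps (fps_deriv F) has_real_derivative eval_fps (fps_deriv (fps_deriv F)) 0) (at 0)"
    by (rule has_field_derivative_eval_fps) (use radF'[of 0] r in simp)
  moreover have "eval_fps (fps_deriv (fps_deriv F)) 0 = 2 * c 2" "eval_fps (fps_deriv F) 0 = c 1"
    by (simp_all add: eval_fps_at_0 F_def numeral_2_eq_2)
  ultimately show ?thesis
    using 1 by (intro exI[of _ "eval_fps (fps_deriv F)"]) auto
qed

text \<open>The quotient rule for \<open>p' / p\<close>, with second derivative
  \<open>2 * c 2\<close> at \<open>0\<close>. Continuity keeps \<open>p\<close> positive near
  \<open>0\<close>, so the inner derivative has this form on a neighbourhood.\<close>

lemma second_derivative_ln_power_series: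
  fixes p :: "real \<Rightarrow> real"
  assumes r: "0 < r" and p: "\<And>t. \<bar>t\<bar> < r \<Longrightarrow> (\<lambda>n. c n * t ^ n) sums p t" and c0: "0 < c 0"
  shows "deriv (deriv (\<lambda>t. ln (p t))) 0 = (2 * c 2 * c 0 - (c 1)\<^sup>2) / (c 0)\<^sup>2"
proof -
  obtain p' where p': "\<And>t. \<bar>t\<bar> < r \<Longrightarrow> (p has_real_derivative p' t) (at t)"
    "p' 0 = c 1" "(p' has_real_derivative 2 * c 2) (at 0)"
    using second_derivative_power_series[OF r p] by blast
  have p0: "p 0 = c 0"
    using p[of 0] r sums_unique2[of "\<lambda>n. c n * 0 ^ n" "p 0" "c 0"] powser_sums_zero[of c] by simp
  have "isCont p 0"
    using p'(1)[of 0] r DERIV_isCont by simp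
  then have "(p \<longlongrightarrow> p 0) (nhds 0)"
    unfolding isCont_def tendsto_at_iff_tendsto_nhds .
  then have "\<forall>\<^sub>F t in nhds 0. 0 < p t"
    using c0 p0 by (intro order_tendstoD(1)) auto
  moreover have "\<forall>\<^sub>F t in nhds (0::real). \<bar>t\<bar> < r"
    using r by (intro eventually_nhds_in_open[of "{-r<..<r}", THEN eventually_mono]) auto
  ultimately have "\<forall>\<^sub>F t in nhds 0. deriv (\<lambda>t. ln (p t)) t = p' t / p t"
  proof eventually_elim
    case (elim t)
    have "((\<lambda>t. ln (p t)) has_real_derivative p' t / p t) (at t)"
      using p'(1)[of t] elim by (auto intro!: derivative_eq_intros)
    then show ?case
      by (rule DERIV_imp_deriv)
  qed
  then have "deriv (deriv (\<lambda>t. ln (p t))) 0 = deriv (\<lambda>t. p' t / p t) 0"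
    by (rule deriv_cong_ev) simp
  also have "\<dots> = (2 * c 2 * p 0 - p' 0 * p' 0) / (p 0 * p 0)"
    by (rule DERIV_imp_deriv, rule DERIV_divide)
      (use p'(1)[of 0] p'(3) r c0 p0 in auto)
  finally show ?thesis
    by (simp add: p0 p'(2) power2_eq_square)
qed

text \<open>A product of geometric series of ratio \<open>cmod t / r\<close> dominates the double
  series, so it converges absolutely and may be summed by rows or along antidiagonals.\<close>

lemma double_series_diagonal_sums:
  fixes b :: "nat \<Rightarrow> nat \<Rightarrow> complex"
  assumes r: "0 < r" and b: "\<And>n m. cmod (b n m) \<le> M / r ^ (n + m)"
    and h: "\<And>n. (\<lambda>m. b n m * t ^ m) sums h n" and s: "(\<lambda>n. h n * t ^ n) sums s"
    and t: "cmod t < r"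
  shows "(\<lambda>N. (\<Sum>n\<le>N. b n (N - n)) * t ^ N) sums s"
proof -
  define f where "f = (\<lambda>(n, m). b n m * t ^ (n + m))"
  define q where "q = cmod t / r"
  have q: "0 \<le> q" "q < 1"
    using r t unfolding q_def by auto
  have M: "0 \<le> M"
    using b[of 0 0] norm_ge_zero[of "b 0 0"] by (simp del: norm_ge_zero)
  have fle: "norm (f p) \<le> M * (q ^ fst p * q ^ snd p)" for p
  proof (cases p)
    case (Pair n m)
    have "norm (f p) \<le> M / r ^ (n + m) * cmod t ^ (n + m)"
      unfolding f_def Pair using mult_right_mono[OF b[of n m], of "cmod t ^ (n + m)"]
      by (simp add: norm_mult norm_power)
    then show ?thesis
      unfolding Pair q_def by (simp add: power_divide power_add)
  qed
  have geo: "(\<lambda>n. norm (c * q ^ n)) summable_on UNIV" for c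
    using q by (subst summable_on_UNIV_nonneg_real_iff) (auto simp: abs_mult intro!: summable_mult summable_geometric)
  have "(\<lambda>p. norm (M * (q ^ fst p * q ^ snd p))) summable_on UNIV \<times> UNIV"
    unfolding Infinite_Sum.abs_summable_on_Sigma_iff
  proof (intro conjI ballI)
    show "(\<lambda>m. norm (M * (q ^ fst (n, m) * q ^ snd (n, m)))) summable_on UNIV" for n
      using geo[of "M * q ^ n"] by (simp add: mult.assoc)
    have "(\<Sum>\<^sub>\<infinity>m. norm (M * (q ^ fst (n, m) * q ^ snd (n, m)))) = (M * (\<Sum>\<^sub>\<infinity>m. q ^ m)) * q ^ n" for n
      using M q by (simp add: abs_mult infsum_cmult_right')
    then show "(\<lambda>n. norm (\<Sum>\<^sub>\<infinity>m. norm (M * (q ^ fst (n, m) * q ^ snd (n, m))))) summable_on UNIV"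
      using geo by presburger
  qed
  then have fs: "(\<lambda>p. norm (f p)) summable_on UNIV \<times> UNIV"
    by (rule Infinite_Sum.abs_summable_on_comparison_test) (use fle M q in \<open>auto simp: abs_mult intro: order_trans\<close>)
  then obtain S where S: "(f has_sum S) (UNIV \<times> UNIV)"
    using abs_summable_summable summable_on_def by blast
  have row: "((\<lambda>m. f (n, m)) has_sum h n * t ^ n) UNIV" for n
  proof (rule norm_summable_imp_has_sum)
    show "summable (\<lambda>m. norm (f (n, m)))"
    proof (rule summable_comparison_test')
      show "summable (\<lambda>m. M * q ^ n * q ^ m)"
        using q by (intro summable_mult summable_geometric) simp
      show "norm (norm (f (n, m))) \<le> M * q ^ n * q ^ m" for m
        using fle[of "(n, m)"] by (simp add: mult.assoc)
    qed
    show "(\<lambda>m. f (n, m)) sums (h n * t ^ n)"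
      using sums_mult2[OF h[of n], of "t ^ n"] by (simp add: f_def power_add mult_ac)
  qed
  have "((\<lambda>n. h n * t ^ n) has_sum S) UNIV"
    by (rule has_sum_Sigma[OF isUCont_plus S row])
  then have "S = s"
    using has_sum_imp_sums s sums_unique2 by blast
  moreover have "bij_betw (\<lambda>(N, n). (n, N - n)) (SIGMA N:UNIV. {..N}) (UNIV \<times> (UNIV :: nat set))"
    by (rule bij_betwI[where g = "\<lambda>(n, m). (n + m, n)"]) auto
  ultimately have "((\<lambda>(N, n). f (n, N - n)) has_sum s) (SIGMA N:UNIV. {..N})"
    using S has_sum_reindex_bij_betw[of "\<lambda>(N, n). (n, N - n)" _ _ f s] by (simp add: case_prod_beta')
  then have "((\<lambda>N. \<Sum>n\<le>N. f (n, N - n)) has_sum s) UNIV"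
    by (rule has_sum_Sigma[OF isUCont_plus]) (simp add: has_sum_finiteI)
  then have "(\<lambda>N. \<Sum>n\<le>N. f (n, N - n)) sums s"
    by (rule has_sum_imp_sums)
  moreover have "(\<Sum>n\<le>N. f (n, N - n)) = (\<Sum>n\<le>N. b n (N - n)) * t ^ N" for N
    unfolding f_def sum_distrib_right by (intro sum.cong) auto
  ultimately show ?thesis
    by simp
qed

section \<open>The Levi form of the squared norm of an antiholomorphic curve\<close>

text \<open>Test with the difference \<open>g - g'\<close>. This is the uniqueness behind the
  definite description of the Bergman kernel.\<close>

lemma (in function_hilbert_space) ip_right_unique:
  assumes g: "g \<in> V" "g' \<in> V" and eq: "\<And>f. f \<in> V \<Longrightarrow> ip f g = ip f g'"
  shows "g = g'"
proof -
  let ?d = "\<lambda>x. g x + - 1 * g' x"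
  have d: "?d \<in> V"
    by (rule comb_closed[OF g])
  have "ip ?d ?d = ip ?d g + cnj (- 1) * ip ?d g'"
    using ip_add_right[OF g(1) scale_closed[OF g(2)] d, of "- 1"] ip_scale_right[OF g(2) d, of "- 1"]
    by simp
  also have "\<dots> = 0"
    using eq[OF d] by simp
  finally have "?d = (\<lambda>_. 0)"
    by (rule ip_definite[OF d])
  then show ?thesis
    by (auto simp: fun_eq_iff)
qed

text \<open>If \<open>k\<close> is an antiholomorphic curve in the space, with Taylor expansion
  \<open>k \<zeta> = \<Sum>n. cnj \<zeta> ^ n \<alpha>\<^sub>n\<close>, then a quarter of the sum of the two second derivatives is
  \<open>(|\<alpha>\<^sub>0|^2 |\<alpha>\<^sub>1|^2 - |(\<alpha>\<^sub>0, \<alpha>\<^sub>1)|^2) / |\<alpha>\<^sub>0|^4\<close>.\<close>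

lemma (in function_hilbert_space) levi_form_ln_pos:
  assumes R: "0 < R" and k: "\<And>\<zeta>. \<zeta> \<in> ball 0 R \<Longrightarrow> k \<zeta> \<in> V"
    and hol: "\<And>f. f \<in> V \<Longrightarrow> (\<lambda>\<zeta>. ip f (k \<zeta>)) holomorphic_on ball 0 R"
    and bd: "\<And>\<zeta>. \<zeta> \<in> ball 0 R \<Longrightarrow> sqn (k \<zeta>) \<le> M"
    and e: "e \<in> V" "ip e (k 0) \<noteq> 0"
    and h: "h \<in> V" "ip h (k 0) = 0" "deriv (\<lambda>\<zeta>. ip h (k \<zeta>)) 0 \<noteq> 0"
  shows "0 < deriv (deriv (\<lambda>t::real. ln (sqn (k (of_real t))))) 0
           + deriv (deriv (\<lambda>t::real. ln (sqn (k (\<i> * of_real t))))) 0"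
proof -
  \<comment> \<open>Cauchy's estimates need a closed disc inside the region of holomorphy.\<close>
  define r where "r = R / 2"
  have r: "0 < r" "r < R"
    using R unfolding r_def by auto
  have M: "0 \<le> M"
    using bd[of 0] sqn_nonneg[OF k[of 0]] R by simp
  \<comment> \<open>The \<open>n\<close>-th Taylor coefficient of the pairing with \<open>f\<close>;
    by Cauchy's inequality it is a bounded linear functional of \<open>f\<close>, to which Riesz
    applies.\<close>
  define a where "a n f = (deriv ^^ n) (\<lambda>\<zeta>. ip f (k \<zeta>)) 0 / fact n" for n f
  have a_bound: "(cmod (a n f))\<^sup>2 \<le> M / r ^ (2 * n) * sqn f" if f: "f \<in> V" for n f
  proof -
    have "norm ((deriv ^^ n) (\<lambda>\<zeta>. ip f (k \<zeta>)) 0) \<le> fact n * sqrt (sqn f * M) / r ^ n"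
    proof (rule Cauchy_inequality[OF _ _ r(1)])
      show "(\<lambda>\<zeta>. ip f (k \<zeta>)) holomorphic_on ball 0 r"
        by (rule holomorphic_on_subset[OF hol[OF f]]) (use r in auto)
      show "continuous_on (cball 0 r) (\<lambda>\<zeta>. ip f (k \<zeta>))"
        by (rule continuous_on_subset[OF holomorphic_on_imp_continuous_on[OF hol[OF f]]]) (use r in auto)
      show "cmod (ip f (k \<zeta>)) \<le> sqrt (sqn f * M)" if "cmod (0 - \<zeta>) = r" for \<zeta>
      proof (rule real_le_rsqrt)
        have \<zeta>: "\<zeta> \<in> ball 0 R"
          using that r by simp
        show "(cmod (ip f (k \<zeta>)))\<^sup>2 \<le> sqn f * M"
          using Cauchy_Schwarz[OF f k[OF \<zeta>]] mult_left_mono[OF bd[OF \<zeta>] sqn_nonneg[OF f]] by linarith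
      qed
    qed
    then have "cmod (a n f) \<le> sqrt (sqn f * M) / r ^ n"
      unfolding a_def by (simp add: norm_divide field_simps)
    then have "(cmod (a n f))\<^sup>2 \<le> (sqrt (sqn f * M) / r ^ n)\<^sup>2"
      by (rule power_mono) simp
    also have "\<dots> = M / r ^ (2 * n) * sqn f"
      using M sqn_nonneg[OF f] by (simp add: power_divide power_mult[symmetric] mult.commute)
    finally show ?thesis .
  qed
  have "\<exists>g\<in>V. \<forall>f\<in>V. a n f = ip f g" for n
  proof (rule Riesz_representation[OF _ _ a_bound])
    have 0: "(0::complex) \<in> ball 0 R"
      using R by simp
    show "a n (\<lambda>x. f x + g x) = a n f + a n g" if f: "f \<in> V" and g: "g \<in> V" for f g
    proof -
      have "(deriv ^^ n) (\<lambda>\<zeta>. ip (\<lambda>x. f x + g x) (k \<zeta>)) 0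
          = (deriv ^^ n) (\<lambda>\<zeta>. ip f (k \<zeta>) + ip g (k \<zeta>)) 0"
        by (rule higher_deriv_cong_ev, rule eventually_nhds_in_open[OF open_ball 0, THEN eventually_mono])
          (auto simp: ip_add[OF f g k])
      then show ?thesis
        unfolding a_def using higher_deriv_add[OF hol[OF f] hol[OF g] open_ball 0, of n]
        by (simp add: add_divide_distrib)
    qed
    show "a n (\<lambda>x. c * f x) = c * a n f" if f: "f \<in> V" for f c
    proof -
      have "(deriv ^^ n) (\<lambda>\<zeta>. ip (\<lambda>x. c * f x) (k \<zeta>)) 0 = (deriv ^^ n) (\<lambda>\<zeta>. c * ip f (k \<zeta>)) 0"
        by (rule higher_deriv_cong_ev, rule eventually_nhds_in_open[OF open_ball 0, THEN eventually_mono])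
          (auto simp: ip_scale[OF f k])
      then show ?thesis
        unfolding a_def using higher_deriv_cmult[OF hol[OF f] 0 open_ball, of n c] by simp
    qed
  qed
  then obtain \<alpha> where \<alpha>: "\<And>n. \<alpha> n \<in> V" "\<And>n f. f \<in> V \<Longrightarrow> a n f = ip f (\<alpha> n)"
    by metis
  have series: "(\<lambda>n. ip f (\<alpha> n) * \<zeta> ^ n) sums ip f (k \<zeta>)" if f: "f \<in> V" and \<zeta>: "\<zeta> \<in> ball 0 R" for f \<zeta>
    using holomorphic_power_series[OF hol[OF f] \<zeta>] \<alpha>(2)[OF f] unfolding a_def by simp
  \<comment> \<open>The functional bound is tested on its own representing vector, and one factor
    \<open>sqn (\<alpha> n)\<close> cancels.\<close>
  have \<alpha>_norm: "sqn (\<alpha> n) \<le> M / r ^ (2 * n)" for n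
  proof (cases "sqn (\<alpha> n) = 0")
    case True
    then show ?thesis
      using M r by simp
  next
    case False
    then have p: "0 < sqn (\<alpha> n)"
      using sqn_nonneg[OF \<alpha>(1)[of n]] by simp
    have "(sqn (\<alpha> n))\<^sup>2 \<le> M / r ^ (2 * n) * sqn (\<alpha> n)"
      using a_bound[OF \<alpha>(1), of n n] \<alpha>(2)[OF \<alpha>(1), of n n] ip_self[OF \<alpha>(1), of n] p by simp
    then show ?thesis
      using p unfolding power2_eq_square by (rule mult_right_le_imp_le)
  qed
  have \<alpha>_ip: "cmod (ip (\<alpha> n) (\<alpha> m)) \<le> M / r ^ (n + m)" for n m
  proof (rule power2_le_imp_le)
    have "(cmod (ip (\<alpha> n) (\<alpha> m)))\<^sup>2 \<le> sqn (\<alpha> n) * sqn (\<alpha> m)"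
      by (rule Cauchy_Schwarz) (rule \<alpha>)+
    also have "\<dots> \<le> (M / r ^ (2 * n)) * (M / r ^ (2 * m))"
      using M r by (intro mult_mono \<alpha>_norm sqn_nonneg \<alpha>) auto
    also have "\<dots> = (M / r ^ (n + m))\<^sup>2"
      by (simp add: power2_eq_square power_add mult_2)
    finally show "(cmod (ip (\<alpha> n) (\<alpha> m)))\<^sup>2 \<le> (M / r ^ (n + m))\<^sup>2" .
  qed (use M r in simp)
  define P where "P = ip (\<alpha> 0) (\<alpha> 1)"
  define Q where "Q = ip (\<alpha> 0) (\<alpha> 2)"
  define A where "A = sqn (\<alpha> 0)"
  define B where "B = sqn (\<alpha> 1)"
  have A0: "A \<noteq> 0"
  proof
    assume "A = 0"
    then have "ip e (\<alpha> 0) = 0"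
      using Cauchy_Schwarz[OF e(1) \<alpha>(1), of 0] unfolding A_def by simp
    then show False
      using \<alpha>(2)[OF e(1), of 0] e(2) unfolding a_def by simp
  qed
  then have A: "0 < A"
    using sqn_nonneg[OF \<alpha>(1)[of 0]] unfolding A_def by simp
  \<comment> \<open>A unimodular \<omega> treats the directions \<open>1\<close> and
    \<open>\<i>\<close> at once.\<close>
  have second: "deriv (deriv (\<lambda>t::real. ln (sqn (k (\<omega> * of_real t))))) 0
      = (2 * (B + 2 * Re (\<omega>\<^sup>2 * Q)) * A - (2 * Re (\<omega> * P))\<^sup>2) / A\<^sup>2" if \<omega>: "cmod \<omega> = 1" for \<omega>
  proof -
    \<comment> \<open>The term of bidegree \<open>(n, m)\<close> in
      \<open>ip (k \<zeta>) (k \<zeta>)\<close> at \<open>\<zeta> = \<omega> * of_real t\<close>,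
      with \<open>t ^ (n + m)\<close> removed.\<close>
    define b where "b n m = ip (\<alpha> m) (\<alpha> n) * \<omega> ^ n * cnj \<omega> ^ m" for n m
    define c where "c N = Re (\<Sum>n\<le>N. b n (N - n))" for N
    have sums: "(\<lambda>N. c N * t ^ N) sums sqn (k (\<omega> * of_real t))" if t: "\<bar>t\<bar> < r" for t :: real
    proof -
      let ?\<zeta> = "\<omega> * of_real t"
      have \<zeta>: "?\<zeta> \<in> ball 0 R"
        using t r \<omega> by (simp add: norm_mult)
      have "(\<lambda>N. (\<Sum>n\<le>N. b n (N - n)) * of_real t ^ N) sums ip (k ?\<zeta>) (k ?\<zeta>)"
      proof (rule double_series_diagonal_sums[OF r(1)])
        show "cmod (b n m) \<le> M / r ^ (n + m)" for n m
          unfolding b_def using \<alpha>_ip[of m n] \<omega> by (simp add: norm_mult norm_power add.commute)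
        show "(\<lambda>m. b n m * of_real t ^ m) sums (ip (k ?\<zeta>) (\<alpha> n) * \<omega> ^ n)" for n
        proof -
          have "(\<lambda>m. cnj (ip (\<alpha> n) (\<alpha> m) * ?\<zeta> ^ m)) sums cnj (ip (\<alpha> n) (k ?\<zeta>))"
            unfolding sums_cnj by (rule series[OF \<alpha>(1) \<zeta>])
          then have "(\<lambda>m. ip (\<alpha> m) (\<alpha> n) * (cnj \<omega> ^ m * of_real t ^ m)) sums ip (k ?\<zeta>) (\<alpha> n)"
            by (simp add: ip_cnj[OF \<alpha>(1) \<alpha>(1)] ip_cnj[OF \<alpha>(1) k[OF \<zeta>]] power_mult_distrib)
          from sums_mult2[OF this, of "\<omega> ^ n"] show ?thesis
            unfolding b_def by (simp add: mult_ac)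
        qed
        show "(\<lambda>n. ip (k ?\<zeta>) (\<alpha> n) * \<omega> ^ n * of_real t ^ n) sums ip (k ?\<zeta>) (k ?\<zeta>)"
          using series[OF k[OF \<zeta>] \<zeta>] by (simp add: power_mult_distrib mult.assoc)
      qed (use t in simp)
      then have "(\<lambda>N. Re ((\<Sum>n\<le>N. b n (N - n)) * of_real t ^ N)) sums Re (ip (k ?\<zeta>) (k ?\<zeta>))"
        by (rule sums_Re)
      moreover have "Re ((\<Sum>n\<le>N. b n (N - n)) * of_real t ^ N) = c N * t ^ N" for N
        unfolding c_def by (simp flip: of_real_power)
      ultimately show ?thesis
        unfolding sqn_def by (simp only:)
    qed
    have cnj\<omega>: "\<omega> * cnj \<omega> = 1"
      using \<omega> complex_norm_square[of \<omega>] by simp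
    have cP: "ip (\<alpha> 1) (\<alpha> 0) = cnj P" and cQ: "ip (\<alpha> 2) (\<alpha> 0) = cnj Q"
      unfolding P_def Q_def using ip_cnj[OF \<alpha>(1) \<alpha>(1)] by auto
    have c0: "c 0 = A"
      unfolding c_def b_def A_def sqn_def by simp
    have "b 0 1 + b 1 0 = cnj (\<omega> * P) + \<omega> * P"
      unfolding b_def using cP by (simp add: P_def mult.commute)
    then have c1: "c 1 = 2 * Re (\<omega> * P)"
      unfolding c_def by simp
    have "b 0 2 + b 1 1 + b 2 0 = cnj (\<omega>\<^sup>2 * Q) + of_real B + \<omega>\<^sup>2 * Q"
    proof -
      have "b 1 1 = of_real B"
        unfolding b_def B_def using ip_self[OF \<alpha>(1), of 1] cnj\<omega> by simp
      then show ?thesis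
        unfolding b_def using cQ by (simp add: Q_def mult.commute)
    qed
    then have c2: "c 2 = B + 2 * Re (\<omega>\<^sup>2 * Q)"
      unfolding c_def by (simp add: numeral_2_eq_2)
    show ?thesis
      using second_derivative_ln_power_series[OF r(1) sums] A unfolding c0 c1 c2 by simp
  qed
  have "a 0 h = 0" "a 1 h \<noteq> 0"
    using h unfolding a_def by auto
  \<comment> \<open>\<open>h\<close> is orthogonal to \<open>\<alpha> 0\<close> but not to
    \<open>\<alpha> 1\<close>, which makes Cauchy-Schwarz strict.\<close>
  then have "(cmod P)\<^sup>2 < A * B"
    unfolding P_def A_def B_def
    using A0 \<alpha>(2)[OF h(1)] by (intro Cauchy_Schwarz_strict[OF \<alpha>(1) \<alpha>(1) h(1)]) (auto simp: A_def)
  then have "0 < 4 * (A * B - (cmod P)\<^sup>2) / A\<^sup>2"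
    using A by simp
  \<comment> \<open>The terms in \<open>Q\<close> cancel because
    \<open>1 + \<i>\<^sup>2 = 0\<close>, and the squares of \<open>Re P\<close> and
    \<open>Re (\<i> * P)\<close> add up to \<open>(cmod P)\<^sup>2\<close>.\<close>
  also have "4 * (A * B - (cmod P)\<^sup>2) / A\<^sup>2 =
      (2 * (B + 2 * Re (1\<^sup>2 * Q)) * A - (2 * Re (1 * P))\<^sup>2) / A\<^sup>2
    + (2 * (B + 2 * Re (\<i>\<^sup>2 * Q)) * A - (2 * Re (\<i> * P))\<^sup>2) / A\<^sup>2"
    unfolding cmod_power2 add_divide_distrib[symmetric] by (simp add: algebra_simps power_mult_distrib)
  also have "\<dots> = deriv (deriv (\<lambda>t::real. ln (sqn (k (1 * of_real t))))) 0
           + deriv (deriv (\<lambda>t::real. ln (sqn (k (\<i> * of_real t))))) 0"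
    by (subst (1 2) second) auto
  finally show ?thesis
    by simp
qed

section \<open>The Bergman space and the Bergman kernel\<close>

definition bergman_ip :: "(complex ^ 'n) set \<Rightarrow> (complex ^ 'n \<Rightarrow> complex) \<Rightarrow> (complex ^ 'n \<Rightarrow> complex) \<Rightarrow> complex" where
  "bergman_ip D f g = integral\<^sup>L (lebesgue_on D) (\<lambda>z. f z * cnj (g z))"

definition sq_norm :: "(complex ^ 'n) set \<Rightarrow> (complex ^ 'n \<Rightarrow> complex) \<Rightarrow> real" where
  "sq_norm D f = integral\<^sup>L (lebesgue_on D) (\<lambda>z. (cmod (f z))\<^sup>2)"

lemma holo_derivative_bound:
  fixes z0 :: "complex ^ 'n"
  assumes f: "holo D f" and ball: "ball z0 r \<subseteq> D" and B: "\<And>w. w \<in> ball z0 r \<Longrightarrow> cmod (f w) \<le> B"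
    and w: "w \<in> ball z0 (r / 2)" and r: "0 < r"
  shows "cmod (frechet_derivative f (at w) h) \<le> 4 * B / r * norm h"
proof (cases "h = 0")
  case True
  have "w \<in> D"
    using w ball r by (auto simp: subset_iff)
  then show ?thesis
    using holo_derivative_scale[OF f, of w 0 0] True by simp
next
  case False
  \<comment> \<open>Chosen so that \<open>s * norm h = r / 4\<close>: starting in the half ball, the
    disc stays in the full ball, and \<open>B / s\<close> is the stated bound.\<close>
  define s where "s = r / (4 * norm h)"
  have s: "0 < s"
    using False r unfolding s_def by simp
  have sh: "s * norm h = r / 4"
    using False unfolding s_def by simp
  have in_ball: "w + \<zeta> *s h \<in> ball z0 r" if "cmod \<zeta> \<le> s" for \<zeta>
  proof -
    have "norm (\<zeta> *s h) \<le> s * norm h"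
      unfolding norm_vector_scale using that by (intro mult_right_mono) auto
    then have "dist w (w + \<zeta> *s h) \<le> r / 4"
      using sh by (simp add: dist_norm)
    moreover have "dist z0 w < r / 2"
      using w by simp
    moreover have "dist z0 (w + \<zeta> *s h) \<le> dist z0 w + dist w (w + \<zeta> *s h)"
      by (rule dist_triangle)
    ultimately show ?thesis
      using r by simp
  qed
  define \<phi> where "\<phi> = (\<lambda>\<zeta>. f (w + \<zeta> *s h))"
  have hol: "\<phi> holomorphic_on cball 0 s"
    unfolding \<phi>_def by (rule holo_line[OF f]) (use in_ball ball in auto)
  have "norm ((deriv ^^ 1) \<phi> 0) \<le> fact 1 * B / s ^ 1"
  proof (rule Cauchy_inequality[OF _ _ s])
    show "\<phi> holomorphic_on ball 0 s" "continuous_on (cball 0 s) \<phi>"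
      using hol ball_subset_cball by (auto intro: holomorphic_on_subset holomorphic_on_imp_continuous_on)
    show "cmod (\<phi> x) \<le> B" if "cmod (0 - x) = s" for x
      unfolding \<phi>_def using that by (intro B in_ball) simp
  qed
  moreover have "deriv \<phi> 0 = frechet_derivative f (at w) h"
  proof -
    have "w + 0 *s h \<in> D"
      using in_ball[of 0] ball s by auto
    then show ?thesis
      unfolding \<phi>_def using DERIV_imp_deriv[OF holo_line_derivative[OF f, of w 0 h]] by simp
  qed
  ultimately show ?thesis
    using False r unfolding s_def by (simp add: field_simps)
qed

section \<open>Square integrable holomorphic functions: local bounds and completeness\<close>

context
  fixes D :: "(complex ^ 'n) set"
  assumes D: "open D"
begin

lemma D_lebesgue: "D \<in> sets lebesgue"
  using D by (simp add: lebesgue_openin)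

lemma A2_holo: "f \<in> A2 D \<Longrightarrow> holo D f"
  unfolding A2_def by simp

lemma A2_integrable: "f \<in> A2 D \<Longrightarrow> integrable (lebesgue_on D) (\<lambda>z. (cmod (f z))\<^sup>2)"
  unfolding A2_def by simp

lemma holo_measurable: "holo D f \<Longrightarrow> f \<in> borel_measurable (lebesgue_on D)"
  using continuous_imp_measurable_on_sets_lebesgue[OF holo_continuous_on D_lebesgue] by blast

lemma A2_add_scale:
  assumes f: "f \<in> A2 D" and g: "g \<in> A2 D"
  shows "(\<lambda>z. f z + c * g z) \<in> A2 D"
proof -
  note [measurable] = holo_measurable[OF A2_holo[OF f]] holo_measurable[OF A2_holo[OF g]]
  have "integrable (lebesgue_on D) (\<lambda>z. 2 * (cmod (f z))\<^sup>2 + 2 * (cmod c)\<^sup>2 * (cmod (g z))\<^sup>2)"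
    using A2_integrable[OF f] A2_integrable[OF g] by simp
  moreover have "(cmod (f z + c * g z))\<^sup>2 \<le> 2 * (cmod (f z))\<^sup>2 + 2 * (cmod c)\<^sup>2 * (cmod (g z))\<^sup>2" for z
  proof -
    have "(cmod (f z + c * g z))\<^sup>2 \<le> (cmod (f z) + cmod c * cmod (g z))\<^sup>2"
      using norm_triangle_ineq[of "f z" "c * g z"] by (intro power_mono) (auto simp: norm_mult)
    also have "\<dots> \<le> 2 * (cmod (f z))\<^sup>2 + 2 * (cmod c * cmod (g z))\<^sup>2"
      using sum_squares_bound[of "cmod (f z)" "cmod c * cmod (g z)"] unfolding power2_sum by linarith
    finally show ?thesis
      by (simp add: power_mult_distrib)
  qed
  then have "norm ((cmod (f z + c * g z))\<^sup>2) \<le> norm (2 * (cmod (f z))\<^sup>2 + 2 * (cmod c)\<^sup>2 * (cmod (g z))\<^sup>2)" for z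
    by (smt (verit) real_norm_def zero_le_power2)
  ultimately have "integrable (lebesgue_on D) (\<lambda>z. (cmod (f z + c * g z))\<^sup>2)"
    by (intro Bochner_Integration.integrable_bound[of "lebesgue_on D"
          "\<lambda>z. 2 * (cmod (f z))\<^sup>2 + 2 * (cmod c)\<^sup>2 * (cmod (g z))\<^sup>2" "\<lambda>z. (cmod (f z + c * g z))\<^sup>2"] AE_I2) measurable
  moreover have "holo D (\<lambda>z. f z + c * g z)"
    by (intro holo_add holo_mult holo_const A2_holo f g)
  ultimately show ?thesis
    unfolding A2_def by simp
qed

lemma bergman_ip_integrable:
  assumes f: "f \<in> A2 D" and g: "g \<in> A2 D"
  shows "integrable (lebesgue_on D) (\<lambda>z. f z * cnj (g z))"
proof (rule Bochner_Integration.integrable_bound)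
  note [measurable] = holo_measurable[OF A2_holo[OF f]] holo_measurable[OF A2_holo[OF g]]
  show "integrable (lebesgue_on D) (\<lambda>z. (cmod (f z))\<^sup>2 + (cmod (g z))\<^sup>2)"
    using A2_integrable[OF f] A2_integrable[OF g] by simp
  show "(\<lambda>z. f z * cnj (g z)) \<in> borel_measurable (lebesgue_on D)"
    using borel_measurable_continuous_on[OF continuous_on_cnj[OF continuous_on_id] holo_measurable[OF A2_holo[OF g]]]
    by measurable
  have "cmod (f z) * cmod (g z) \<le> (cmod (f z))\<^sup>2 + (cmod (g z))\<^sup>2" for z
    using sum_squares_bound[of "cmod (f z)" "cmod (g z)"]
      mult_nonneg_nonneg[OF norm_ge_zero[of "f z"] norm_ge_zero[of "g z"]] by linarith
  then show "AE z in lebesgue_on D. norm (f z * cnj (g z)) \<le> norm ((cmod (f z))\<^sup>2 + (cmod (g z))\<^sup>2)"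
    by (simp add: norm_mult)
qed

lemma bergman_ip_self: "bergman_ip D f f = of_real (sq_norm D f)"
  unfolding bergman_ip_def sq_norm_def complex_norm_square[symmetric] by (rule integral_complex_of_real)

text \<open>Passes from the Lebesgue measure of the definitions to \<open>lborel\<close>, on which
  the mean value inequality is stated.\<close>

lemma nn_integral_sq_norm:
  assumes "f \<in> A2 D"
  shows "(\<integral>\<^sup>+z. ennreal ((cmod (f z))\<^sup>2) * indicator D z \<partial>lborel) = ennreal (sq_norm D f)"
proof -
  have "(\<integral>\<^sup>+z. ennreal ((cmod (f z))\<^sup>2) \<partial>lebesgue_on D) = ennreal (sq_norm D f)"
    unfolding sq_norm_def by (rule nn_integral_eq_integral[OF A2_integrable[OF assms]]) simp
  then show ?thesis
    using D_lebesgue by (simp add: nn_integral_restrict_space nn_integral_completion)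
qed

text \<open>The mean value inequality bounds point evaluations, uniformly near \<open>z0\<close>.
  This feeds the Riesz theorem, completeness, definiteness and the bound on the kernel.\<close>

lemma A2_local_bound:
  assumes "z0 \<in> D"
  shows "\<exists>r>0. \<exists>M\<ge>0. ball z0 r \<subseteq> D \<and> (\<forall>f\<in>A2 D. \<forall>w\<in>ball z0 r. (cmod (f w))\<^sup>2 \<le> M * sq_norm D f)"
proof -
  obtain e where e: "e > 0" "ball z0 e \<subseteq> D"
    using D assms openE by blast
  \<comment> \<open>With half the radius, a ball of radius \<open>r\<close> around any point of
    \<open>ball z0 r\<close> stays in \<open>D\<close>, so all these points share the constant
    \<open>1 / v\<close>.\<close>
  define r where "r = e / 2"
  have r: "r > 0" "ball z0 r \<subseteq> D"
    using e unfolding r_def by (auto simp: subset_iff)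
  define v where "v = unit_ball_vol (real DIM(complex ^ 'n)) * r ^ DIM(complex ^ 'n)"
  have v: "v > 0"
    unfolding v_def using r(1) by simp
  have "(cmod (f w))\<^sup>2 \<le> 1 / v * sq_norm D f" if f: "f \<in> A2 D" and w: "w \<in> ball z0 r" for f w
  proof -
    have sub: "ball w r \<subseteq> D"
    proof
      fix x assume "x \<in> ball w r"
      then have "dist z0 x < e"
        using w dist_triangle[of z0 x w] unfolding r_def by simp
      then show "x \<in> D"
        using e(2) by auto
    qed
    have "ennreal ((cmod (f w))\<^sup>2 * v) = ennreal ((cmod (f w))\<^sup>2) * emeasure lborel (ball w r)"
      unfolding v_def using r(1) by (simp add: emeasure_ball ennreal_mult)
    also have "\<dots> \<le> (\<integral>\<^sup>+z. ennreal ((cmod (f z))\<^sup>2) * indicator (ball w r) z \<partial>lborel)"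
      by (rule holo_sub_mean_value[OF A2_holo[OF f] sub])
    also have "\<dots> \<le> (\<integral>\<^sup>+z. ennreal ((cmod (f z))\<^sup>2) * indicator D z \<partial>lborel)"
      using sub by (intro nn_integral_mono mult_left_mono) (auto simp: indicator_def)
    also have "\<dots> = ennreal (sq_norm D f)"
      by (rule nn_integral_sq_norm[OF f])
    finally have "(cmod (f w))\<^sup>2 * v \<le> sq_norm D f"
      by (simp add: ennreal_le_iff sq_norm_def)
    then show ?thesis
      using v by (simp add: field_simps)
  qed
  then show ?thesis
    using r v by (intro exI[of _ r] exI[of _ "1 / v"] conjI) auto
qed

lemma sq_norm_nonneg: "0 \<le> sq_norm D f"
  unfolding sq_norm_def by simp

text \<open>By the local bound a Cauchy sequence in square norm is locally uniformly Cauchy;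
  Cauchy's estimate extends this to derivatives, and termwise differentiation applies.\<close>

lemma A2_pointwise_limit_holo:
  assumes F: "\<And>n. F n \<in> A2 D"
    and Cauchy: "\<And>e. e > 0 \<Longrightarrow> \<exists>N. \<forall>m\<ge>N. \<forall>n\<ge>N. sq_norm D (\<lambda>z. F m z + - 1 * F n z) < e"
  shows "\<exists>f. holo D f \<and> (\<forall>z\<in>D. (\<lambda>n. F n z) \<longlonglongrightarrow> f z)"
proof -
  define F' where "F' n z = frechet_derivative (F n) (at z)" for n z
  define g' where "g' z h = lim (\<lambda>n. F' n z h)" for z h
  define f where "f z = lim (\<lambda>n. F n z)" for z
  have local: "\<exists>r>0. ball z0 r \<subseteq> D \<and>
      (\<forall>e>0. \<exists>N. \<forall>m\<ge>N. \<forall>n\<ge>N. \<forall>w\<in>ball z0 r. cmod (F m w - F n w) \<le> e \<and> (\<forall>h. cmod (F' m w h - F' n w h) \<le> e * norm h))"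
    if z0: "z0 \<in> D" for z0
  proof -
    obtain r M where r: "r > 0" "M \<ge> 0" "ball z0 r \<subseteq> D"
      "\<And>f w. f \<in> A2 D \<Longrightarrow> w \<in> ball z0 r \<Longrightarrow> (cmod (f w))\<^sup>2 \<le> M * sq_norm D f"
      using A2_local_bound[OF z0] by metis
    have "\<exists>N. \<forall>m\<ge>N. \<forall>n\<ge>N. \<forall>w\<in>ball z0 (r/2). cmod (F m w - F n w) \<le> e \<and> (\<forall>h. cmod (F' m w h - F' n w h) \<le> e * norm h)"
      if e: "e > 0" for e
    proof -
      \<comment> \<open>Makes both the values and, through the factor \<open>4 / r\<close> of
        \<open>holo_derivative_bound\<close>, the derivatives differ by at most
        \<open>e\<close>.\<close>
      define B where "B = min e (e * r / 4)"
      have B: "B > 0"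
        unfolding B_def using e r by simp
      \<comment> \<open>The denominator \<open>M + 1\<close> covers the case
        \<open>M = 0\<close>.\<close>
      obtain N where N: "\<And>m n. m \<ge> N \<Longrightarrow> n \<ge> N \<Longrightarrow> sq_norm D (\<lambda>z. F m z + - 1 * F n z) < B\<^sup>2 / (M + 1)"
        using Cauchy[of "B\<^sup>2 / (M + 1)"] B r(2) by auto
      show ?thesis
      proof (intro exI[of _ N] allI impI ballI)
        fix m n w assume mn: "N \<le> m" "N \<le> n" and w: "w \<in> ball z0 (r/2)"
        let ?G = "\<lambda>z. F m z + - 1 * F n z"
        have G: "?G \<in> A2 D"
          by (rule A2_add_scale[OF F F])
        have bd: "cmod (?G x) \<le> B" if x: "x \<in> ball z0 r" for x
        proof -
          have "M * sq_norm D ?G \<le> (M + 1) * (B\<^sup>2 / (M + 1))"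
            using N[OF mn] r(2) sq_norm_nonneg[of ?G] by (intro mult_mono) auto
          then have "(cmod (?G x))\<^sup>2 \<le> B\<^sup>2"
            using r(2) r(4)[OF G x] by simp
          then show ?thesis
            using B by (simp add: power2_le_iff_abs_le)
        qed
        have wr: "w \<in> ball z0 r"
          using w r(1) by simp
        have wD: "w \<in> D"
          using wr r(3) by blast
        have "F' m w h - F' n w h = frechet_derivative ?G (at w) h" for h
        proof -
          have "(?G has_derivative (\<lambda>h. F' m w h + - 1 * F' n w h)) (at w)"
            unfolding F'_def
            by (intro has_derivative_add has_derivative_mult_right holo_has_derivative[OF A2_holo[OF F] wD])
          then show ?thesis
            by (simp add: frechet_derivative_eqI)
        qed
        moreover have "cmod (frechet_derivative ?G (at w) h) \<le> 4 * B / r * norm h" for h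
          by (rule holo_derivative_bound[OF A2_holo[OF G] r(3) bd w r(1)])
        moreover have "4 * B / r * norm h \<le> e * norm h" for h :: "complex ^ 'n"
          using r(1) unfolding B_def by (intro mult_right_mono) (auto simp: field_simps)
        ultimately show "cmod (F m w - F n w) \<le> e \<and> (\<forall>h. cmod (F' m w h - F' n w h) \<le> e * norm h)"
          using bd[OF wr] unfolding B_def by (auto intro: order_trans)
      qed
    qed
    then show ?thesis
      using r by (intro exI[of _ "r/2"]) (auto simp: subset_iff)
  qed
  have Flim: "(\<lambda>n. F n z) \<longlonglongrightarrow> f z" and F'lim: "(\<lambda>n. F' n z h) \<longlonglongrightarrow> g' z h" if z: "z \<in> D" for z h
  proof -
    obtain r where r: "r > 0" "\<And>e. e > 0 \<Longrightarrow> \<exists>N. \<forall>m\<ge>N. \<forall>n\<ge>N. \<forall>w\<in>ball z r.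
        cmod (F m w - F n w) \<le> e \<and> (\<forall>h. cmod (F' m w h - F' n w h) \<le> e * norm h)"
      using local[OF z] by blast
    have zz: "z \<in> ball z r"
      using r(1) by simp
    have "Cauchy (\<lambda>n. F n z)"
    proof (rule CauchyI)
      fix e :: real assume "e > 0"
      then show "\<exists>N. \<forall>m\<ge>N. \<forall>n\<ge>N. norm (F m z - F n z) < e"
        using r(2)[of "e/2"] zz by (smt (verit) field_sum_of_halves half_gt_zero)
    qed
    then show "(\<lambda>n. F n z) \<longlonglongrightarrow> f z"
      unfolding f_def using Cauchy_convergent_iff convergent_LIMSEQ_iff by blast
    have "Cauchy (\<lambda>n. F' n z h)"
    proof (rule CauchyI)
      fix e :: real assume e: "e > 0"
      define d where "d = e / (norm h + 1)"
      have d: "d > 0"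
        unfolding d_def using e by (simp add: add_nonneg_pos)
      have "d * norm h < e"
        unfolding d_def using e by (simp add: pos_divide_less_eq add_nonneg_pos)
      then show "\<exists>N. \<forall>m\<ge>N. \<forall>n\<ge>N. norm (F' m z h - F' n z h) < e"
        using r(2)[OF d] zz by (meson le_less_trans)
    qed
    then show "(\<lambda>n. F' n z h) \<longlonglongrightarrow> g' z h"
      unfolding g'_def using Cauchy_convergent_iff convergent_LIMSEQ_iff by blast
  qed
  have "(f has_derivative g' z0) (at z0)" if z0: "z0 \<in> D" for z0
  proof -
    obtain r where r: "r > 0" "ball z0 r \<subseteq> D" "\<And>e. e > 0 \<Longrightarrow> \<exists>N. \<forall>m\<ge>N. \<forall>n\<ge>N. \<forall>w\<in>ball z0 r.
        cmod (F m w - F n w) \<le> e \<and> (\<forall>h. cmod (F' m w h - F' n w h) \<le> e * norm h)"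
      using local[OF z0] by blast
    have zz: "z0 \<in> ball z0 r"
      using r(1) by simp
    have "\<exists>g. \<forall>x\<in>ball z0 r. (\<lambda>n. F n x) \<longlonglongrightarrow> g x \<and> (g has_derivative g' x) (at x within ball z0 r)"
    proof (rule has_derivative_sequence[where f = F and f' = F' and g' = g' and l = "f z0", OF convex_ball _ _ zz Flim[OF z0]])
      show "(F n has_derivative F' n x) (at x within ball z0 r)" if "x \<in> ball z0 r" for n x
        unfolding F'_def using that r(2)
        by (intro has_derivative_at_withinI[OF holo_has_derivative[OF A2_holo[OF F]]]) auto
      fix e :: real assume "e > 0"
      then obtain N where N: "\<And>m n w h. m \<ge> N \<Longrightarrow> n \<ge> N \<Longrightarrow> w \<in> ball z0 r \<Longrightarrow> cmod (F' m w h - F' n w h) \<le> e * norm h"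
        using r(3) by meson
      have "norm (F' m w h - g' w h) \<le> e * norm h" if m: "m \<ge> N" and w: "w \<in> ball z0 r" for m w h
      proof (rule LIMSEQ_le_const2)
        show "(\<lambda>n. norm (F' m w h - F' n w h)) \<longlonglongrightarrow> norm (F' m w h - g' w h)"
          using w r(2) by (intro tendsto_intros F'lim) auto
        show "\<exists>N. \<forall>n\<ge>N. norm (F' m w h - F' n w h) \<le> e * norm h"
          using N m w by blast
      qed
      then show "\<forall>\<^sub>F n in sequentially. \<forall>x\<in>ball z0 r. \<forall>h. norm (F' n x h - g' x h) \<le> e * norm h"
        unfolding eventually_sequentially by blast
    qed
    then obtain g where g: "\<And>x. x \<in> ball z0 r \<Longrightarrow> (\<lambda>n. F n x) \<longlonglongrightarrow> g x"
      "\<And>x. x \<in> ball z0 r \<Longrightarrow> (g has_derivative g' x) (at x within ball z0 r)"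
      by blast
    have "g x = f x" if "x \<in> ball z0 r" for x
      using LIMSEQ_unique g(1)[OF that] Flim[of x] that r(2) by blast
    moreover have "(g has_derivative g' z0) (at z0)"
      using g(2)[OF zz] at_within_open[OF zz open_ball] by simp
    ultimately show ?thesis
      using has_derivative_cong_open[OF open_ball zz] by metis
  qed
  moreover have "g' z (c *s v) = c * g' z v" if z: "z \<in> D" for z c v
  proof (rule LIMSEQ_unique[OF F'lim[OF z]])
    have "(\<lambda>n. c * F' n z v) \<longlonglongrightarrow> c * g' z v"
      by (intro tendsto_intros F'lim z)
    then show "(\<lambda>n. F' n z (c *s v)) \<longlonglongrightarrow> c * g' z v"
      unfolding F'_def by (simp add: holo_derivative_scale[OF A2_holo[OF F] z])
  qed
  ultimately have "holo D f"
    unfolding holo_def by blast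
  then show ?thesis
    using Flim by blast
qed

text \<open>Fatou's lemma, applied to \<open>F n - F m\<close> as \<open>m\<close> tends to
  infinity, upgrades the pointwise limit to a limit in square norm.\<close>

lemma A2_complete:
  assumes F: "\<And>n. F n \<in> A2 D"
    and Cauchy: "\<And>e. e > 0 \<Longrightarrow> \<exists>N. \<forall>m\<ge>N. \<forall>n\<ge>N. sq_norm D (\<lambda>z. F m z + - 1 * F n z) < e"
  shows "\<exists>f\<in>A2 D. (\<forall>z\<in>D. (\<lambda>n. F n z) \<longlonglongrightarrow> f z) \<and> (\<lambda>n. sq_norm D (\<lambda>z. F n z + - 1 * f z)) \<longlonglongrightarrow> 0"
proof -
  obtain f where f: "holo D f" "\<And>z. z \<in> D \<Longrightarrow> (\<lambda>n. F n z) \<longlonglongrightarrow> f z"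
    using A2_pointwise_limit_holo[OF F Cauchy] by blast
  note [measurable] = holo_measurable[OF A2_holo[OF F]] holo_measurable[OF f(1)]
  have dist: "(\<lambda>z. F n z + - 1 * f z) \<in> A2 D \<and> sq_norm D (\<lambda>z. F n z + - 1 * f z) \<le> e"
    if e: "e > 0" and N: "\<And>m. m \<ge> N \<Longrightarrow> sq_norm D (\<lambda>z. F n z + - 1 * F m z) < e" for e n N
  proof -
    have "(\<integral>\<^sup>+z. ennreal ((cmod (F n z + - 1 * f z))\<^sup>2) \<partial>lebesgue_on D)
        = (\<integral>\<^sup>+z. liminf (\<lambda>m. ennreal ((cmod (F n z + - 1 * F m z))\<^sup>2)) \<partial>lebesgue_on D)"
    proof (rule nn_integral_cong)
      fix z assume "z \<in> space (lebesgue_on D)"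
      then have "z \<in> D"
        by simp
      then have "(\<lambda>m. ennreal ((cmod (F n z + - 1 * F m z))\<^sup>2)) \<longlonglongrightarrow> ennreal ((cmod (F n z + - 1 * f z))\<^sup>2)"
        by (intro tendsto_ennrealI tendsto_intros f)
      then show "ennreal ((cmod (F n z + - 1 * f z))\<^sup>2) = liminf (\<lambda>m. ennreal ((cmod (F n z + - 1 * F m z))\<^sup>2))"
        by (intro lim_imp_Liminf[symmetric]) auto
    qed
    also have "\<dots> \<le> liminf (\<lambda>m. \<integral>\<^sup>+z. ennreal ((cmod (F n z + - 1 * F m z))\<^sup>2) \<partial>lebesgue_on D)"
      by (rule nn_integral_liminf) measurable
    also have "(\<lambda>m. \<integral>\<^sup>+z. ennreal ((cmod (F n z + - 1 * F m z))\<^sup>2) \<partial>lebesgue_on D)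
        = (\<lambda>m. ennreal (sq_norm D (\<lambda>z. F n z + - 1 * F m z)))"
      unfolding sq_norm_def
      by (intro ext nn_integral_eq_integral A2_integrable A2_add_scale F) simp
    also have "liminf \<dots> \<le> liminf (\<lambda>m::nat. ennreal e)"
      using N by (intro Liminf_mono) (auto simp: eventually_sequentially intro!: exI[of _ N] ennreal_leI[OF less_imp_le])
    also have "\<dots> = ennreal e"
      by (simp add: Liminf_const)
    finally have le: "(\<integral>\<^sup>+z. ennreal ((cmod (F n z + - 1 * f z))\<^sup>2) \<partial>lebesgue_on D) \<le> ennreal e" .
    have int: "integrable (lebesgue_on D) (\<lambda>z. (cmod (F n z + - 1 * f z))\<^sup>2)"
    proof (rule integrableI_nonneg)
      show "(\<lambda>z. (cmod (F n z + - 1 * f z))\<^sup>2) \<in> borel_measurable (lebesgue_on D)"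
        by measurable
      show "(\<integral>\<^sup>+z. ennreal ((cmod (F n z + - 1 * f z))\<^sup>2) \<partial>lebesgue_on D) < \<infinity>"
        using le by (simp add: le_less_trans)
    qed simp
    have "ennreal (sq_norm D (\<lambda>z. F n z + - 1 * f z)) \<le> ennreal e"
      unfolding sq_norm_def by (subst nn_integral_eq_integral[OF int, symmetric]) (use le in auto)
    then have "sq_norm D (\<lambda>z. F n z + - 1 * f z) \<le> e"
      using e by (simp add: ennreal_le_iff)
    moreover have "holo D (\<lambda>z. F n z + - 1 * f z)"
      by (intro holo_add holo_mult holo_const A2_holo F f)
    ultimately show ?thesis
      using int unfolding A2_def by simp
  qed
  obtain N where "\<forall>m\<ge>N. \<forall>n\<ge>N. sq_norm D (\<lambda>z. F m z + - 1 * F n z) < 1"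
    using Cauchy[of 1] by auto
  then have "(\<lambda>z. F N z + - 1 * f z) \<in> A2 D"
    using dist[of 1 N N] by simp
  \<comment> \<open>\<open>f\<close> equals \<open>F N - (F N - f)\<close>.\<close>
  from A2_add_scale[OF F this, of N "-1"] have "f \<in> A2 D"
    by simp
  moreover have "(\<lambda>n. sq_norm D (\<lambda>z. F n z + - 1 * f z)) \<longlonglongrightarrow> 0"
  proof (rule LIMSEQ_I)
    fix e :: real assume e: "e > 0"
    obtain N where N: "\<forall>m\<ge>N. \<forall>n\<ge>N. sq_norm D (\<lambda>z. F m z + - 1 * F n z) < e / 2"
      using Cauchy[of "e / 2"] e by auto
    have "norm (sq_norm D (\<lambda>z. F n z + - 1 * f z) - 0) < e" if "n \<ge> N" for n
      using dist[of "e / 2" N n] N that e sq_norm_nonneg[of "\<lambda>z. F n z + - 1 * f z"] by simp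
    then show "\<exists>N. \<forall>n\<ge>N. norm (sq_norm D (\<lambda>z. F n z + - 1 * f z) - 0) < e"
      by blast
  qed
  ultimately show ?thesis
    using f(2) by blast
qed

end

text \<open>Vanishing off \<open>D\<close> turns agreement on \<open>D\<close> into equality of
  functions, as definiteness requires, and matches the normalisation in
  \<open>bergman_kernel\<close>.\<close>

definition bergman_space :: "(complex ^ 'n) set \<Rightarrow> (complex ^ 'n \<Rightarrow> complex) set" where
  "bergman_space D = {f \<in> A2 D. \<forall>z. z \<notin> D \<longrightarrow> f z = 0}"

section \<open>The Hilbert space structure, the reproducing kernel and positivity of the
  metric\<close>

context
  fixes D :: "(complex ^ 'n) set"
  assumes D: "open D"
begin

lemma bergman_ip_cong:
  "(\<And>z. z \<in> D \<Longrightarrow> f z = f' z) \<Longrightarrow> (\<And>z. z \<in> D \<Longrightarrow> g z = g' z) \<Longrightarrow> bergman_ip D f g = bergman_ip D f' g'"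
  unfolding bergman_ip_def by (rule Bochner_Integration.integral_cong) auto

lemma sq_norm_cong: "(\<And>z. z \<in> D \<Longrightarrow> f z = f' z) \<Longrightarrow> sq_norm D f = sq_norm D f'"
  unfolding sq_norm_def by (rule Bochner_Integration.integral_cong) auto

lemma zero_in_A2: "(\<lambda>_. 0) \<in> A2 D"
  unfolding A2_def by (simp add: holo_const)

lemma restrict_in_bergman_space:
  assumes "f \<in> A2 D"
  shows "mult_op D (\<lambda>_. 1) f \<in> bergman_space D"
proof -
  have "integrable (lebesgue_on D) (\<lambda>z. (cmod (mult_op D (\<lambda>_. 1) f z))\<^sup>2)"
    using A2_integrable[OF D assms]
    by (rule Bochner_Integration.integrable_cong[THEN iffD2, rotated 2]) (auto simp: mult_op_def)
  then show ?thesis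
    using holo_mult_op[OF D holo_const A2_holo[OF D assms], of 1]
    unfolding bergman_space_def A2_def by (auto simp: mult_op_def)
qed

lemma bergman_hilbert: "function_hilbert_space (bergman_space D) (bergman_ip D)"
proof
  show "(\<lambda>_. 0) \<in> bergman_space D"
    unfolding bergman_space_def using zero_in_A2 by simp
  show "(\<lambda>x. f x + g x) \<in> bergman_space D" if "f \<in> bergman_space D" "g \<in> bergman_space D" for f g
    using that A2_add_scale[OF D, of f g 1] unfolding bergman_space_def by auto
  show "(\<lambda>x. c * f x) \<in> bergman_space D" if "f \<in> bergman_space D" for f c
    using that A2_add_scale[OF D zero_in_A2, of f c] unfolding bergman_space_def by auto
  fix f assume f: "f \<in> bergman_space D"
  then have fA: "f \<in> A2 D"
    unfolding bergman_space_def by simp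
  show "0 \<le> Re (bergman_ip D f f)"
    unfolding bergman_ip_self[OF D] by (simp add: sq_norm_def)
  \<comment> \<open>Bounded point evaluations make \<open>f\<close> vanish at every point of
    \<open>D\<close>, not merely almost everywhere.\<close>
  show "f = (\<lambda>_. 0)" if "bergman_ip D f f = 0"
  proof
    fix w show "f w = 0"
    proof (cases "w \<in> D")
      case True
      then obtain M where "(cmod (f w))\<^sup>2 \<le> M * sq_norm D f"
        using A2_local_bound[OF D True] fA centre_in_ball by blast
      moreover have "sq_norm D f = 0"
        using that unfolding bergman_ip_self[OF D] by simp
      ultimately show ?thesis
        by simp
    next
      case False
      then show ?thesis
        using f unfolding bergman_space_def by simp
    qed
  qed
  fix h assume h: "h \<in> bergman_space D"
  then have hA: "h \<in> A2 D"
    unfolding bergman_space_def by simp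
  show "bergman_ip D (\<lambda>x. c * f x) h = c * bergman_ip D f h" for c
    unfolding bergman_ip_def by (simp add: mult.assoc)
  show "cnj (bergman_ip D f h) = bergman_ip D h f"
  proof -
    have "cnj (bergman_ip D f h) = integral\<^sup>L (lebesgue_on D) (\<lambda>z. cnj (f z * cnj (h z)))"
      unfolding bergman_ip_def by (rule Bochner_Integration.integral_cnj[symmetric])
    then show ?thesis
      unfolding bergman_ip_def by (simp add: mult.commute)
  qed
  fix g assume g: "g \<in> bergman_space D"
  then have gA: "g \<in> A2 D"
    unfolding bergman_space_def by simp
  show "bergman_ip D (\<lambda>x. f x + g x) h = bergman_ip D f h + bergman_ip D g h"
    unfolding bergman_ip_def
    using bergman_ip_integrable[OF D fA hA] bergman_ip_integrable[OF D gA hA] by (simp add: distrib_right)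
next
  fix F :: "nat \<Rightarrow> complex ^ 'n \<Rightarrow> complex"
  assume F: "\<And>n. F n \<in> bergman_space D"
    and C: "\<And>e. e > 0 \<Longrightarrow> \<exists>N. \<forall>m\<ge>N. \<forall>n\<ge>N.
      Re (bergman_ip D (\<lambda>x. F m x + - 1 * F n x) (\<lambda>x. F m x + - 1 * F n x)) < e"
  have "\<And>n. F n \<in> A2 D"
    using F unfolding bergman_space_def by simp
  then obtain f where f: "f \<in> A2 D" "(\<lambda>n. sq_norm D (\<lambda>z. F n z + - 1 * f z)) \<longlonglongrightarrow> 0"
    using A2_complete[OF D, of F] C unfolding bergman_ip_self[OF D] Re_complex_of_real by blast
  \<comment> \<open>The limit in \<open>A2 D\<close> may be nonzero off \<open>D\<close>; cutting it
    off changes no integral over \<open>D\<close>.\<close>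
  have "sq_norm D (\<lambda>z. F n z + - 1 * f z) = sq_norm D (\<lambda>z. F n z + - 1 * mult_op D (\<lambda>_. 1) f z)" for n
    by (rule sq_norm_cong) (simp add: mult_op_def)
  then show "\<exists>f\<in>bergman_space D. (\<lambda>n. Re (bergman_ip D (\<lambda>x. F n x + - 1 * f x) (\<lambda>x. F n x + - 1 * f x))) \<longlonglongrightarrow> 0"
    unfolding bergman_ip_self[OF D] Re_complex_of_real using f restrict_in_bergman_space by auto
qed

interpretation bergman: function_hilbert_space "bergman_space D" "bergman_ip D"
  by (rule bergman_hilbert)

lemma bergman_sqn: "bergman.sqn f = sq_norm D f"
  unfolding bergman.sqn_def bergman_ip_self[OF D] by simp

text \<open>Justifies the definite description: Riesz gives existence,
  \<open>ip_right_unique\<close> uniqueness.\<close>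

lemma bergman_kernel_reproducing:
  assumes w: "w \<in> D"
  shows "bergman_kernel D w \<in> bergman_space D"
    and "\<And>f. f \<in> bergman_space D \<Longrightarrow> f w = bergman_ip D f (bergman_kernel D w)"
proof -
  obtain r M where r: "r > 0" "\<And>f v. f \<in> A2 D \<Longrightarrow> v \<in> ball w r \<Longrightarrow> (cmod (f v))\<^sup>2 \<le> M * sq_norm D f"
    using A2_local_bound[OF D w] by metis
  have "\<exists>g\<in>bergman_space D. \<forall>f\<in>bergman_space D. f w = bergman_ip D f g"
    by (rule bergman.Riesz_representation[where C = M])
      (use r in \<open>auto simp: bergman_sqn bergman_space_def\<close>)
  then obtain g where g: "g \<in> bergman_space D" "\<And>f. f \<in> bergman_space D \<Longrightarrow> f w = bergman_ip D f g"
    by blast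
  \<comment> \<open>The description quantifies over all of \<open>A2 D\<close>, including functions
    that do not vanish off \<open>D\<close>.\<close>
  have gA: "f w = bergman_ip D f g" if "f \<in> A2 D" for f
    using g(2)[OF restrict_in_bergman_space[OF that]] w
      bergman_ip_cong[of "mult_op D (\<lambda>_. 1) f" f g g] by (simp add: mult_op_def)
  have "bergman_kernel D w = g"
    unfolding bergman_kernel_def bergman_ip_def[symmetric]
  proof (rule the_equality)
    show "g \<in> A2 D \<and> (\<forall>z. z \<notin> D \<longrightarrow> g z = 0) \<and> (\<forall>f\<in>A2 D. f w = bergman_ip D f g)"
      using g gA unfolding bergman_space_def by auto
    show "g' = g" if "g' \<in> A2 D \<and> (\<forall>z. z \<notin> D \<longrightarrow> g' z = 0) \<and> (\<forall>f\<in>A2 D. f w = bergman_ip D f g')" for g'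
      using that g by (intro bergman.ip_right_unique) (auto simp: bergman_space_def)
  qed
  then show "bergman_kernel D w \<in> bergman_space D"
    "\<And>f. f \<in> bergman_space D \<Longrightarrow> f w = bergman_ip D f (bergman_kernel D w)"
    using g by auto
qed

text \<open>The reproducing property applied to the kernel itself; it turns
  \<open>log_bergman\<close> into the logarithm of a squared norm.\<close>

lemma bergman_kernel_diag:
  assumes "w \<in> D"
  shows "Re (bergman_kernel D w w) = sq_norm D (bergman_kernel D w)"
  using bergman_kernel_reproducing(2)[OF assms bergman_kernel_reproducing(1)[OF assms]]
  by (simp add: bergman_ip_self[OF D])

text \<open>A bounded open set has finite measure. This supplies the constant and affine test
  functions.\<close>

lemma bounded_holo_in_A2:
  assumes "bounded D" "holo D f" "\<And>z. z \<in> D \<Longrightarrow> cmod (f z) \<le> C"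
  shows "f \<in> A2 D"
proof -
  have [measurable]: "f \<in> borel_measurable (lebesgue_on D)"
    by (rule holo_measurable[OF D assms(2)])
  have "D \<in> lmeasurable"
    using assms(1) D by (simp add: lmeasurable_open)
  then have "finite_measure (lebesgue_on D)"
    by (simp add: finite_measure_lebesgue_on)
  moreover have "(cmod (f z))\<^sup>2 \<le> C\<^sup>2" if "z \<in> D" for z
    using assms(3)[OF that] by (intro power_mono) auto
  ultimately have "integrable (lebesgue_on D) (\<lambda>z. (cmod (f z))\<^sup>2)"
    by (intro finite_measure.integrable_const_bound[where B = "C\<^sup>2"]) auto
  then show ?thesis
    using assms(2) unfolding A2_def by simp
qed

text \<open>The kernels at \<open>z + \<zeta> *s u\<close> form the antiholomorphic curve of
  \<open>levi_form_ln_pos\<close>: pairing with \<open>f\<close> gives \<open>f\<close> on the line,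
  hence a holomorphic function of \<zeta>.\<close>

theorem bergman_metric_pos:
  assumes bdd: "bounded D" and z: "z \<in> D" and u: "u \<noteq> 0"
  shows "0 < bergman_metric D z u"
proof -
  obtain r M where r: "r > 0" "M \<ge> 0" "ball z r \<subseteq> D"
    "\<And>f w. f \<in> A2 D \<Longrightarrow> w \<in> ball z r \<Longrightarrow> (cmod (f w))\<^sup>2 \<le> M * sq_norm D f"
    using A2_local_bound[OF D z] by metis
  define R where "R = r / norm u"
  have R: "R > 0"
    using r u unfolding R_def by simp
  have in_D: "z + \<zeta> *s u \<in> ball z r" "z + \<zeta> *s u \<in> D" if "\<zeta> \<in> ball 0 R" for \<zeta>
  proof -
    have "cmod \<zeta> * norm u < r"
      using that u unfolding R_def by (simp add: pos_less_divide_eq)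
    then show "z + \<zeta> *s u \<in> ball z r"
      by (simp add: dist_norm norm_vector_scale)
    then show "z + \<zeta> *s u \<in> D"
      using r(3) by blast
  qed
  define k where "k \<zeta> = bergman_kernel D (z + \<zeta> *s u)" for \<zeta>
  have k: "k \<zeta> \<in> bergman_space D" if "\<zeta> \<in> ball 0 R" for \<zeta>
    unfolding k_def using in_D that by (intro bergman_kernel_reproducing)
  have ipk: "bergman_ip D f (k \<zeta>) = f (z + \<zeta> *s u)" if "f \<in> bergman_space D" "\<zeta> \<in> ball 0 R" for f \<zeta>
    unfolding k_def using bergman_kernel_reproducing(2)[OF in_D(2)[OF that(2)] that(1)] by simp
  have holo: "holo D f" if "f \<in> bergman_space D" for f
    using that unfolding bergman_space_def A2_def by simp
  have zero: "0 \<in> ball (0::complex) R"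
    using R by simp
  \<comment> \<open>The Hermitian product of \<open>w - z\<close> with \<open>u\<close>: it vanishes
    at \<open>z\<close> and has slope \<open>(norm u)\<^sup>2\<close> along
    \<open>u\<close>.\<close>
  define l where "l = (\<lambda>w :: complex ^ 'n. \<Sum>i\<in>UNIV. cnj (u $ i) * (w $ i - z $ i))"
  have l_deriv: "(l has_derivative (\<lambda>v. \<Sum>i\<in>UNIV. cnj (u $ i) * v $ i)) (at w)" for w
  proof -
    have "((\<lambda>w. w $ i) has_derivative (\<lambda>v. v $ i)) (at w)" for i
      by (rule bounded_linear_imp_has_derivative[OF bounded_linear_vec_nth])
    from has_derivative_diff[OF this has_derivative_const]
    have "((\<lambda>w. w $ i - z $ i) has_derivative (\<lambda>v. v $ i)) (at w)" for i
      by simp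
    then show ?thesis
      unfolding l_def by (intro has_derivative_sum has_derivative_mult_right)
  qed
  have l_holo: "holo D l"
    unfolding holo_def using l_deriv by (auto simp: sum_distrib_left mult_ac intro!: exI)
  have l_A2: "l \<in> A2 D"
  proof -
    have "continuous_on (closure D) l"
      by (rule has_derivative_continuous_on, rule has_derivative_at_withinI, rule l_deriv)
    then have "compact (l ` closure D)"
      using bdd by (intro compact_continuous_image) (auto simp: compact_eq_bounded_closed)
    then obtain C where "\<And>w. w \<in> closure D \<Longrightarrow> cmod (l w) \<le> C"
      using compact_imp_bounded bounded_iff by (metis imageI)
    then show ?thesis
      using closure_subset by (intro bounded_holo_in_A2[OF bdd l_holo]) blast
  qed
  define h where "h = mult_op D (\<lambda>_. 1) l"
  have h: "h \<in> bergman_space D"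
    unfolding h_def by (rule restrict_in_bergman_space[OF l_A2])
  have "bergman_ip D h (k 0) = 0"
    using ipk[OF h zero] z by (simp add: h_def mult_op_def l_def)
  moreover have "deriv (\<lambda>\<zeta>. bergman_ip D h (k \<zeta>)) 0 \<noteq> 0"
  proof -
    have eq: "bergman_ip D h (k \<zeta>) = of_real ((norm u)\<^sup>2) * \<zeta>" if "\<zeta> \<in> ball 0 R" for \<zeta>
    proof -
      have "bergman_ip D h (k \<zeta>) = l (z + \<zeta> *s u)"
        using ipk[OF h that] in_D(2)[OF that] by (simp add: h_def mult_op_def)
      also have "\<dots> = (\<Sum>i\<in>UNIV. of_real ((cmod (u $ i))\<^sup>2)) * \<zeta>"
        unfolding l_def complex_norm_square sum_distrib_right by (intro sum.cong) (auto simp: mult_ac)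
      also have "(\<Sum>i\<in>UNIV. of_real ((cmod (u $ i))\<^sup>2)) = complex_of_real ((norm u)\<^sup>2)"
        unfolding norm_vec_def L2_set_def by (simp add: sum_nonneg)
      finally show ?thesis .
    qed
    have "((\<lambda>\<zeta>. of_real ((norm u)\<^sup>2) * \<zeta>) has_field_derivative of_real ((norm u)\<^sup>2)) (at 0)"
      by (auto intro!: derivative_eq_intros)
    then have "((\<lambda>\<zeta>. bergman_ip D h (k \<zeta>)) has_field_derivative of_real ((norm u)\<^sup>2)) (at 0)"
      by (rule has_field_derivative_transform_within_open[OF _ open_ball zero]) (use eq in simp)
    then show ?thesis
      using u DERIV_imp_deriv by fastforce
  qed
  moreover have "mult_op D (\<lambda>_. 1) (\<lambda>_. 1) \<in> bergman_space D" (is "?e \<in> _")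
    by (intro restrict_in_bergman_space bounded_holo_in_A2[OF bdd holo_const, where C = 1]) simp
  moreover from this have "bergman_ip D ?e (k 0) \<noteq> 0"
    using ipk[OF _ zero, of ?e] z by (simp add: mult_op_def)
  moreover have "(\<lambda>\<zeta>. bergman_ip D f (k \<zeta>)) holomorphic_on ball 0 R" if f: "f \<in> bergman_space D" for f
    using holo_line[OF holo[OF f] in_D(2)] by (rule holomorphic_transform) (simp_all add: ipk[OF f])
  \<comment> \<open>The local bound is applied to the kernel at its own base point, where its value
    is its squared norm \<open>s\<close>; hence \<open>s * s \<le> M * s\<close>.\<close>
  moreover have "bergman.sqn (k \<zeta>) \<le> M" if \<zeta>: "\<zeta> \<in> ball 0 R" for \<zeta>
  proof -
    define s where "s = bergman.sqn (k \<zeta>)"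
    have s0: "0 \<le> s"
      unfolding s_def by (rule bergman.sqn_nonneg[OF k[OF \<zeta>]])
    have "k \<zeta> (z + \<zeta> *s u) = of_real s"
      using ipk[OF k[OF \<zeta>] \<zeta>] bergman.ip_self[OF k[OF \<zeta>]] unfolding s_def by simp
    moreover have "(cmod (k \<zeta> (z + \<zeta> *s u)))\<^sup>2 \<le> M * s"
      unfolding s_def bergman_sqn using k[OF \<zeta>] in_D(1)[OF \<zeta>] r(4) unfolding bergman_space_def by blast
    ultimately have "s * s \<le> M * s"
      by (simp add: power2_eq_square)
    then show ?thesis
      using s0 r(2) unfolding s_def[symmetric] by (cases "s = 0") auto
  qed
  ultimately have pos: "0 < deriv (deriv (\<lambda>t::real. ln (bergman.sqn (k (of_real t))))) 0
           + deriv (deriv (\<lambda>t::real. ln (bergman.sqn (k (\<i> * of_real t))))) 0"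
    by (intro bergman.levi_form_ln_pos[OF R k _ _ _ _ h]) auto
  have "deriv (deriv (\<lambda>t::real. log_bergman D (z + t *\<^sub>R (\<omega> *s u)))) 0
      = deriv (deriv (\<lambda>t::real. ln (bergman.sqn (k (\<omega> * of_real t))))) 0" if \<omega>: "cmod \<omega> = 1" for \<omega>
  proof -
    have "log_bergman D (z + t *\<^sub>R (\<omega> *s u)) = ln (bergman.sqn (k (\<omega> * of_real t)))" if t: "t \<in> {-R<..<R}" for t :: real
    proof -
      have "z + t *\<^sub>R (\<omega> *s u) = z + (\<omega> * of_real t) *s u"
        unfolding vector_scaleR_scale by (simp add: vec_eq_iff)
      moreover have "\<omega> * of_real t \<in> ball 0 R"
        using t \<omega> by (simp add: norm_mult abs_less_iff)
      ultimately show ?thesis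
        unfolding log_bergman_def bergman_sqn k_def using bergman_kernel_diag[OF in_D(2)] by simp
    qed
    moreover have "\<forall>\<^sub>F t in nhds 0. t \<in> {-R<..<R}"
      using R by (intro eventually_nhds_in_open) auto
    ultimately have ev: "\<forall>\<^sub>F t in nhds 0. log_bergman D (z + t *\<^sub>R (\<omega> *s u)) = ln (bergman.sqn (k (\<omega> * of_real t)))"
      by (auto elim: eventually_mono)
    \<comment> \<open>Comparing the inner derivatives at each \<open>t\<close> near \<open>0\<close>
      needs agreement on a neighbourhood of that \<open>t\<close>, not just at
      \<open>t\<close>.\<close>
    then have "\<forall>\<^sub>F t in nhds 0. \<forall>\<^sub>F s in nhds t. log_bergman D (z + s *\<^sub>R (\<omega> *s u)) = ln (bergman.sqn (k (\<omega> * of_real s)))"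
      unfolding eventually_eventually .
    then have "\<forall>\<^sub>F t in nhds 0. deriv (\<lambda>s. log_bergman D (z + s *\<^sub>R (\<omega> *s u))) t
        = deriv (\<lambda>s. ln (bergman.sqn (k (\<omega> * of_real s)))) t"
      by eventually_elim (rule deriv_cong_ev, auto)
    then show ?thesis
      by (rule deriv_cong_ev) simp
  qed
  from this[of 1] this[of \<i>] show ?thesis
    unfolding bergman_metric_def using pos by simp
qed

end

theorem mainTheorem8:
  fixes D :: "(complex ^ 'n) set" and \<psi> :: "complex ^ 'n \<Rightarrow> complex"
  assumes "bounded D" and "homogeneous_domain D" and "0 \<in> D"
    and "holo D \<psi>"
  shows "(bounded_op_on (bloch D) (bloch_norm D) (mult_op D \<psi>) \<longrightarrow>
            spectrum_on (bloch D) (bloch_norm D) (mult_op D \<psi>) = closure (\<psi> ` D))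
       \<and> (bounded_op_on (little_bloch_star D) (bloch_norm D) (mult_op D \<psi>) \<longrightarrow>
            spectrum_on (little_bloch_star D) (bloch_norm D) (mult_op D \<psi>) = closure (\<psi> ` D))"
proof -
  have D: "open D" "connected D" "D \<noteq> {}"
    using assms(2) unfolding homogeneous_domain_def domain_def by auto
  note spectrum_mult_op[OF D bergman_metric_pos[OF D(1) assms(1)] assms(4) _ assms(3)]
  then show ?thesis
    by blast
qed

end
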